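(* Let $T\in\mathcal{B}_n(\Omega)$ have the (IR) decomposition $T=\bigoplus_{i=1}^{t}T_i^{(m_i)}$, let $\widetilde{T}\sim_u T$ have the (IR) decomposition $\widetilde{T}=\bigoplus_{i=1}^{t}\widetilde{T}_i^{(l_i)}$, and let $\pi$ be a permutation of $\{1,\dots,t\}$ with $T_i\sim_u\widetilde{T}_{\pi(i)}$ and $m_i=l_{\pi(i)}$ for all $i$. Put $k=\sum_{i=1}^t m_i=\sum_{i=1}^t l_i$ and write $T=\bigoplus_{j=1}^{k}S_j$, $\widetilde{T}=\bigoplus_{j=1}^{k}\widetilde{S}_j$, where the first $m_1$ of the $S_j$ equal $T_1$, the next $m_2$ equal $T_2$, and so on, and the first $l_1$ of the $\widetilde{S}_j$ equal $\widetilde{T}_1$, the next $l_2$ equal $\widetilde{T}_2$, and so on. Let $S_j=(M_z^*,\mathcal{H}_j,K_j)$ and $\widetilde{S}_j=(M_z^*,\widetilde{\mathcal{H}}_j,\widetilde{K}_j)$ for $1\le j\le k$ (with equal spaces and kernels for equal operators), and put $K=\operatorname{diag}(K_1,\dots,K_k)$, $\widetilde{K}=\operatorname{diag}(\widetilde{K}_1,\dots,\widetilde{K}_k)$. Let $\Lambda\subset\Omega^*$ be a nonempty open set and let $\Phi=(\Phi_{i,j})_{i,j=1}^{k}$ be a holomorphic $\mathcal{M}_n(\mathbb{C})$-valued function on $\Lambda$, with $\Phi(\mu)$ invertible for every $\mu\in\Lambda$, such that $$K(\mu,\lambda)=\Phi(\mu)\widetilde{K}(\mu,\lambda)\Phi(\lambda)^*\qquad\text{for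 all }\mu,\lambda\in\Lambda,$$ where $\Phi$ is partitioned into blocks $\Phi_{i,j}$ conformally with $K$ (rows) and $\widetilde{K}$ (columns). Group these blocks as $\Phi=(\widetilde{\Phi}_{i,j})_{i,j=1}^{t}$, where $\widetilde{\Phi}_{i,j}$ consists of $m_i$ rows and $l_j$ columns of blocks $\Phi_{p,q}$. Then $\widetilde{\Phi}_{i,\pi(i)}\neq 0$ and $\widetilde{\Phi}_{i,j}=0$ for all $j\ne\pi(i)$, $1\le i\le t$; moreover each block $\Phi_{i,j}$, $1\le i,j\le k$, is either invertible (at every point of $\Lambda$) or identically zero.
   Context: Let $\Omega\subset\mathbb{C}$ be open and connected, $n$ a positive integer, $\Omega^*=\{\lambda:\overline{\lambda}\in\Omega\}$. For a complex separable Hilbert space $\mathcal{H}$, the Cowen-Douglas class $\mathcal{B}_n(\Omega)$ consists of bounded linear operators $T$ on $\mathcal{H}$ such that: (1) $\Omega\subset\sigma(T)$; (2) $\operatorname{ran}(T-\lambda)=\mathcal{H}$ for every $\lambda\in\Omega$; (3) the closed linear span of $\bigcup_{\lambda\in\Omega}\ker(T-\lambda)$ is $\mathcal{H}$; (4) $\dim\ker(T-\lambda)=n$ for every $\lambda\in\Omega$. The notation $T=(M_z^*,\mathcal{H},K)$ for $T\in\mathcal{B}_n(\Omega)$ means: $\mathcal{H}$ is a Hilbert space of holomorphic $\mathbb{C}^n$-valued functions on $\Omega^*$ with reproducing kernel $K:\Omega^*\times\Omega^*\to\mathcal{M}_n(\mathbb{C})$ (holomorphic in the first variable, anti-holomorphic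 in the second, $\langle f,K(\cdot,\lambda)\xi\rangle=\langle f(\lambda),\xi\rangle$), and $T=M_z^*$ is the adjoint of multiplication by $z$ on $\mathcal{H}$. In this realization $\ker(T-\overline{\lambda})=\{K(\cdot,\lambda)\xi:\xi\in\mathbb{C}^n\}$ for $\lambda\in\Omega^*$, and $K(\lambda,\lambda)$ is positive definite, hence invertible. $T\sim_u S$ means $T$ and $S$ are unitarily equivalent. A bounded operator is irreducible, written $T\in(IR)$, if it has no nontrivial reducing subspace. $T^{(m)}$ is the orthogonal direct sum of $m$ copies of $T$. A decomposition $T=\bigoplus_{i=1}^{t}T_i^{(m_i)}$ of $T\in\mathcal{B}_n(\Omega)$ with $T_i\in\mathcal{B}_{n_i}(\Omega)$, $\sum_i m_in_i=n$, is an (IR) decomposition if each $T_i\in(IR)$ and $T_i\not\sim_u T_j$ for $i\neq j$. (For $\widetilde T\sim_u T$, any two (IR) decompositions of $T$ and $\widetilde T$ have the same number $t$ of distinct summands, and a permutation $\pi$ as in the claim exists.) *)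

theory Defs
  imports
    "HOL-Complex_Analysis.Complex_Analysis"
    "HOL-Library.Function_Algebras"
    "Jordan_Normal_Form.Schur_Decomposition"
begin

unbundle no vec_syntax

section \<open>Complex vector spaces and Hilbert spaces\<close>

class complex_vector = ab_group_add +
  fixes scaleC :: "complex \<Rightarrow> 'a \<Rightarrow> 'a" (infixr \<open>*\<^sub>C\<close> 75)
  assumes scaleC_add_right: "a *\<^sub>C (x + y) = a *\<^sub>C x + a *\<^sub>C y"
    and scaleC_add_left: "(a + b) *\<^sub>C x = a *\<^sub>C x + b *\<^sub>C x"
    and scaleC_scaleC: "a *\<^sub>C (b *\<^sub>C x) = (a * b) *\<^sub>C x"
    and scaleC_one: "1 *\<^sub>C x = x"

global_interpretation complex_vector: vector_space "scaleC :: complex \<Rightarrow> 'a \<Rightarrow> 'a::complex_vector"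
  by unfold_locales
    (simp_all add: scaleC_add_right scaleC_add_left scaleC_scaleC scaleC_one)

instantiation complex :: complex_vector
begin
definition scaleC_complex_def: "(a::complex) *\<^sub>C (x::complex) = a * x"
instance by standard (simp_all add: scaleC_complex_def algebra_simps)
end

instantiation "fun" :: (type, complex_vector) complex_vector
begin
definition scaleC_fun_def: "a *\<^sub>C f = (\<lambda>x. a *\<^sub>C f x)"
instance
  by standard
    (simp_all add: scaleC_fun_def fun_eq_iff scaleC_add_right scaleC_add_left scaleC_scaleC scaleC_one)
end

text \<open>Spaces are linear subspaces of an ambient type, each carrying its own inner product; operators
  are total functions of which only the values on the carrier matter.\<close>

record 'a ip_space =
  hcarrier :: "'a set"
  hinner :: "'a \<Rightarrow> 'a \<Rightarrow> complex"

definition hnorm :: "'a::complex_vector ip_space \<Rightarrow> 'a \<Rightarrow> real" where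
  "hnorm H x = sqrt (Re (hinner H x x))"

text \<open>The locale \<^locale>\<open>Metric_space\<close> asks for non-negativity and symmetry on the whole type, hence the
  value 0 off the carrier.\<close>

definition hdist :: "'a::complex_vector ip_space \<Rightarrow> 'a \<Rightarrow> 'a \<Rightarrow> real" where
  "hdist H x y = (if x \<in> hcarrier H \<and> y \<in> hcarrier H then hnorm H (x - y) else 0)"

abbreviation htopology :: "'a::complex_vector ip_space \<Rightarrow> 'a topology" where
  "htopology H \<equiv> Metric_space.mtopology (hcarrier H) (hdist H)"

locale inner_product_space =
  fixes H :: "'a::complex_vector ip_space"
  assumes subspace_hcarrier: "complex_vector.subspace (hcarrier H)"
    and hinner_add_left: "\<lbrakk>x \<in> hcarrier H; y \<in> hcarrier H; z \<in> hcarrier H\<rbrakk>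
          \<Longrightarrow> hinner H (x + y) z = hinner H x z + hinner H y z"
    and hinner_scaleC_left: "\<lbrakk>x \<in> hcarrier H; y \<in> hcarrier H\<rbrakk>
          \<Longrightarrow> hinner H (a *\<^sub>C x) y = a * hinner H x y"
    and hinner_cnj: "\<lbrakk>x \<in> hcarrier H; y \<in> hcarrier H\<rbrakk> \<Longrightarrow> hinner H y x = cnj (hinner H x y)"
    and hinner_pos: "\<lbrakk>x \<in> hcarrier H; x \<noteq> 0\<rbrakk> \<Longrightarrow> 0 < Re (hinner H x x)"
begin

lemma hcarrier_closed:
  "0 \<in> hcarrier H"
  "\<lbrakk>x \<in> hcarrier H; y \<in> hcarrier H\<rbrakk> \<Longrightarrow> x + y \<in> hcarrier H"
  "x \<in> hcarrier H \<Longrightarrow> a *\<^sub>C x \<in> hcarrier H"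
  "\<lbrakk>x \<in> hcarrier H; y \<in> hcarrier H\<rbrakk> \<Longrightarrow> x - y \<in> hcarrier H"
  using subspace_hcarrier
  by (auto intro: complex_vector.subspace_0 complex_vector.subspace_add
      complex_vector.subspace_scale complex_vector.subspace_diff)

lemma hinner_zero_left: "y \<in> hcarrier H \<Longrightarrow> hinner H 0 y = 0"
  using hinner_scaleC_left[of 0 y 0] hcarrier_closed by simp

lemma hinner_add_right:
  assumes "x \<in> hcarrier H" "y \<in> hcarrier H" "z \<in> hcarrier H"
  shows "hinner H z (x + y) = hinner H z x + hinner H z y"
  using assms hinner_cnj[of "x + y" z] hinner_cnj[of x z] hinner_cnj[of y z]
  by (simp add: hinner_add_left hcarrier_closed)

lemma hinner_scaleC_right:
  assumes "x \<in> hcarrier H" "y \<in> hcarrier H"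
  shows "hinner H x (a *\<^sub>C y) = cnj a * hinner H x y"
  using assms hinner_cnj[of "a *\<^sub>C y" x] hinner_cnj[of y x]
  by (simp add: hinner_scaleC_left hcarrier_closed)

lemma hinner_nonneg: "x \<in> hcarrier H \<Longrightarrow> 0 \<le> Re (hinner H x x)"
  using hinner_pos[of x] hinner_zero_left[of 0] hcarrier_closed(1)
  by (cases "x = 0") (auto intro: less_imp_le)

lemma hnorm_power2: "x \<in> hcarrier H \<Longrightarrow> (hnorm H x)\<^sup>2 = Re (hinner H x x)"
  by (simp add: hnorm_def hinner_nonneg)

lemma Re_hinner_le:
  assumes x: "x \<in> hcarrier H" and y: "y \<in> hcarrier H"
  shows "Re (hinner H x y) \<le> hnorm H x * hnorm H y"
proof (cases "x = 0 \<or> y = 0")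
  case True
  then show ?thesis
    using x y hinner_zero_left[of y] hinner_zero_left[of x] hinner_cnj[of 0 x]
    by (auto simp: hnorm_def hinner_zero_left hcarrier_closed)
next
  case False
  define a b where "a = hnorm H x" and "b = hnorm H y"
  have ab: "0 < a" "0 < b"
    using False x y hinner_pos by (auto simp: a_def b_def hnorm_def)
  define u where "u = complex_of_real b *\<^sub>C x + complex_of_real (- a) *\<^sub>C y"
  have sym: "Re (hinner H y x) = Re (hinner H x y)"
    using hinner_cnj[OF x y] by simp
  have "Re (hinner H (complex_of_real r *\<^sub>C x + complex_of_real s *\<^sub>C y)
          (complex_of_real r *\<^sub>C x + complex_of_real s *\<^sub>C y)) =
        r\<^sup>2 * Re (hinner H x x) + s\<^sup>2 * Re (hinner H y y) + 2 * r * s * Re (hinner H x y)" for r s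
    using x y sym
    by (simp add: hinner_add_left hinner_add_right hinner_scaleC_left hinner_scaleC_right
        hcarrier_closed power2_eq_square algebra_simps)
  from this[of b "- a"] have "Re (hinner H u u) = b\<^sup>2 * Re (hinner H x x) + a\<^sup>2 * Re (hinner H y y)
          - 2 * a * b * Re (hinner H x y)"
    by (simp add: u_def)
  also have "\<dots> = 2 * (a * b) * (a * b - Re (hinner H x y))"
    using hnorm_power2[OF x] hnorm_power2[OF y]
    by (simp add: a_def b_def power2_eq_square algebra_simps flip: hnorm_power2)
  finally have "0 \<le> 2 * (a * b) * (a * b - Re (hinner H x y))"
    using hinner_nonneg[of u] x y by (simp add: u_def hcarrier_closed)
  then have "0 \<le> a * b - Re (hinner H x y)"
    using ab mult_pos_pos[OF ab] by (simp add: zero_le_mult_iff)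
  then show ?thesis by (simp add: a_def b_def)
qed

lemma hnorm_triangle:
  assumes x: "x \<in> hcarrier H" and y: "y \<in> hcarrier H"
  shows "hnorm H (x + y) \<le> hnorm H x + hnorm H y"
proof (rule power2_le_imp_le)
  have "Re (hinner H y x) = Re (hinner H x y)"
    using hinner_cnj[OF x y] by simp
  then show "(hnorm H (x + y))\<^sup>2 \<le> (hnorm H x + hnorm H y)\<^sup>2"
    using x y Re_hinner_le[OF x y]
    by (simp add: hnorm_power2 hcarrier_closed power2_sum hinner_add_left hinner_add_right)
  show "0 \<le> hnorm H x + hnorm H y"
    using x y by (simp add: hnorm_def hinner_nonneg)
qed

lemma hnorm_minus_commute:
  assumes "x \<in> hcarrier H" "y \<in> hcarrier H"
  shows "hnorm H (x - y) = hnorm H (y - x)"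
proof -
  have "y - x = (-1) *\<^sub>C (x - y)"
    by simp
  then show ?thesis
    using assms hcarrier_closed(3)[of "x - y" "-1"]
    by (simp only: hnorm_def hinner_scaleC_left hinner_scaleC_right hcarrier_closed) simp
qed

lemma Metric_space_hdist: "Metric_space (hcarrier H) (hdist H)"
proof
  fix x y z
  show "0 \<le> hdist H x y"
    by (auto simp: hdist_def hnorm_def hinner_nonneg hcarrier_closed)
  show "hdist H x y = hdist H y x"
    by (auto simp: hdist_def hnorm_minus_commute)
  show "hdist H x y = 0 \<longleftrightarrow> x = y" if "x \<in> hcarrier H" "y \<in> hcarrier H"
    using that hinner_pos[of "x - y"] hinner_zero_left[of 0]
    by (cases "x = y") (simp_all add: hdist_def hnorm_def hcarrier_closed)
  show "hdist H x z \<le> hdist H x y + hdist H y z"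
    if "x \<in> hcarrier H" "y \<in> hcarrier H" "z \<in> hcarrier H"
    using that hnorm_triangle[of "x - y" "y - z"]
    by (simp add: hdist_def hcarrier_closed)
qed

end

locale separable_hilbert_space = inner_product_space +
  assumes complete_hcarrier: "Metric_space.mcomplete (hcarrier H) (hdist H)"
    and separable_hcarrier: "separable_space (htopology H)"

section \<open>Operators\<close>

definition linear_op :: "'a::complex_vector ip_space \<Rightarrow> 'b::complex_vector ip_space \<Rightarrow> ('a \<Rightarrow> 'b) \<Rightarrow> bool" where
  "linear_op H H' U \<longleftrightarrow>
     (\<forall>x\<in>hcarrier H. U x \<in> hcarrier H') \<and>
     (\<forall>x\<in>hcarrier H. \<forall>y\<in>hcarrier H. U (x + y) = U x + U y) \<and>
     (\<forall>a. \<forall>x\<in>hcarrier H. U (a *\<^sub>C x) = a *\<^sub>C U x)"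

definition bounded_op :: "'a::complex_vector ip_space \<Rightarrow> ('a \<Rightarrow> 'a) \<Rightarrow> bool" where
  "bounded_op H T \<longleftrightarrow> linear_op H H T \<and> (\<exists>C. \<forall>x\<in>hcarrier H. hnorm H (T x) \<le> C * hnorm H x)"

definition spectrum_op :: "'a::complex_vector ip_space \<Rightarrow> ('a \<Rightarrow> 'a) \<Rightarrow> complex set" where
  "spectrum_op H T = {c. \<not> (\<exists>R. bounded_op H R \<and>
     (\<forall>x\<in>hcarrier H. R (T x - c *\<^sub>C x) = x \<and> T (R x) - c *\<^sub>C R x = x))}"

definition eigenspace :: "'a::complex_vector ip_space \<Rightarrow> ('a \<Rightarrow> 'a) \<Rightarrow> complex \<Rightarrow> 'a set" where
  "eigenspace H T c = {x \<in> hcarrier H. T x - c *\<^sub>C x = 0}"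

text \<open>\<open>vector_space.dim\<close> is 0 for infinite-dimensional spaces, so with \<open>n > 0\<close> the last
  condition below says that the kernel is finite-dimensional of dimension \<open>n\<close>.\<close>

definition cowen_douglas ::
  "nat \<Rightarrow> complex set \<Rightarrow> 'a::complex_vector ip_space \<Rightarrow> ('a \<Rightarrow> 'a) \<Rightarrow> bool" where
  "cowen_douglas n \<Omega> H T \<longleftrightarrow>
     0 < n \<and> separable_hilbert_space H \<and> bounded_op H T \<and>
     \<Omega> \<subseteq> spectrum_op H T \<and>
     (\<forall>c\<in>\<Omega>. (\<lambda>x. T x - c *\<^sub>C x) ` hcarrier H = hcarrier H) \<and>
     htopology H closure_of complex_vector.span (\<Union>c\<in>\<Omega>. eigenspace H T c) = hcarrier H \<and>
     (\<forall>c\<in>\<Omega>. complex_vector.dim (eigenspace H T c) = n)"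

definition unitarily_equivalent ::
  "'a::complex_vector ip_space \<Rightarrow> ('a \<Rightarrow> 'a) \<Rightarrow> 'b::complex_vector ip_space \<Rightarrow> ('b \<Rightarrow> 'b) \<Rightarrow> bool" where
  "unitarily_equivalent H T H' T' \<longleftrightarrow>
     (\<exists>U. linear_op H H' U \<and> bij_betw U (hcarrier H) (hcarrier H') \<and>
        (\<forall>x\<in>hcarrier H. \<forall>y\<in>hcarrier H. hinner H' (U x) (U y) = hinner H x y) \<and>
        (\<forall>x\<in>hcarrier H. U (T x) = T' (U x)))"

definition horth :: "'a::complex_vector ip_space \<Rightarrow> 'a set \<Rightarrow> 'a set" where
  "horth H M = {x \<in> hcarrier H. \<forall>y\<in>M. hinner H x y = 0}"

definition reducing_subspace :: "'a::complex_vector ip_space \<Rightarrow> ('a \<Rightarrow> 'a) \<Rightarrow> 'a set \<Rightarrow> bool" where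
  "reducing_subspace H T M \<longleftrightarrow>
     complex_vector.subspace M \<and> closedin (htopology H) M \<and>
     T ` M \<subseteq> M \<and> T ` horth H M \<subseteq> horth H M"

definition irreducible_op :: "'a::complex_vector ip_space \<Rightarrow> ('a \<Rightarrow> 'a) \<Rightarrow> bool" where
  "irreducible_op H T \<longleftrightarrow> (\<forall>M. reducing_subspace H T M \<longrightarrow> M = {0} \<or> M = hcarrier H)"

section \<open>Orthogonal direct sums and (IR) decompositions\<close>

definition dsum_space :: "'a::complex_vector ip_space list \<Rightarrow> (nat \<Rightarrow> 'a) ip_space" where
  "dsum_space Hs =
     \<lparr> hcarrier = {x. (\<forall>j<length Hs. x j \<in> hcarrier (Hs ! j)) \<and> (\<forall>j\<ge>length Hs. x j = 0)},
       hinner = (\<lambda>x y. \<Sum>j<length Hs. hinner (Hs ! j) (x j) (y j)) \<rparr>"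

definition dsum_op :: "('a::complex_vector \<Rightarrow> 'a) list \<Rightarrow> (nat \<Rightarrow> 'a) \<Rightarrow> (nat \<Rightarrow> 'a)" where
  "dsum_op Ts x = (\<lambda>j. if j < length Ts then (Ts ! j) (x j) else 0)"

text \<open>\<open>copies t m X\<close> is \<open>X 0, \<dots>, X 0, X 1, \<dots>, X 1, \<dots>\<close> with \<open>X i\<close> repeated \<open>m i\<close> times for \<open>i < t\<close>.\<close>

definition copies :: "nat \<Rightarrow> (nat \<Rightarrow> nat) \<Rightarrow> (nat \<Rightarrow> 'x) \<Rightarrow> 'x list" where
  "copies t m X = concat (map (\<lambda>i. replicate (m i) (X i)) [0..<t])"

text \<open>\<open>T\<close> on \<open>H\<close> is the orthogonal direct sum of \<open>m i\<close> copies of \<open>Ti i\<close> on \<open>Hi i\<close> for \<open>i < t\<close>,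
  where \<open>Ti i\<close> has Cowen-Douglas rank \<open>d i\<close>.\<close>

definition IR_decomposition ::
  "nat \<Rightarrow> complex set \<Rightarrow> (nat \<Rightarrow> 'a::complex_vector) ip_space \<Rightarrow> ((nat \<Rightarrow> 'a) \<Rightarrow> (nat \<Rightarrow> 'a)) \<Rightarrow>
   nat \<Rightarrow> (nat \<Rightarrow> nat) \<Rightarrow> (nat \<Rightarrow> nat) \<Rightarrow> (nat \<Rightarrow> 'a ip_space) \<Rightarrow> (nat \<Rightarrow> 'a \<Rightarrow> 'a) \<Rightarrow> bool" where
  "IR_decomposition n \<Omega> H T t m d Hi Ti \<longleftrightarrow>
     cowen_douglas n \<Omega> H T \<and>
     H = dsum_space (copies t m Hi) \<and>
     (\<forall>x\<in>hcarrier H. T x = dsum_op (copies t m Ti) x) \<and>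
     (\<forall>i<t. 0 < m i) \<and>
     (\<forall>i<t. cowen_douglas (d i) \<Omega> (Hi i) (Ti i)) \<and>
     (\<Sum>i<t. m i * d i) = n \<and>
     (\<forall>i<t. irreducible_op (Hi i) (Ti i)) \<and>
     (\<forall>i<t. \<forall>j<t. i \<noteq> j \<longrightarrow> \<not> unitarily_equivalent (Hi i) (Ti i) (Hi j) (Ti j))"

section \<open>Reproducing kernel realizations\<close>

text \<open>A \<open>\<complex>\<^sup>n\<close>-valued function on \<open>D\<close> is encoded as \<open>f :: complex \<Rightarrow> nat \<Rightarrow> complex\<close>, where \<open>f z i\<close> is the
  \<open>i\<close>-th coordinate of the value at \<open>z\<close> and \<open>f z i = 0\<close> unless \<open>z \<in> D\<close> and \<open>i < n\<close>.\<close>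

type_synonym vfun = "complex \<Rightarrow> nat \<Rightarrow> complex"

definition holo_vfun :: "nat \<Rightarrow> complex set \<Rightarrow> vfun \<Rightarrow> bool" where
  "holo_vfun n D f \<longleftrightarrow>
     (\<forall>i<n. (\<lambda>z. f z i) holomorphic_on D) \<and> (\<forall>z i. \<not> (z \<in> D \<and> i < n) \<longrightarrow> f z i = 0)"

definition kernel_section ::
  "nat \<Rightarrow> complex set \<Rightarrow> (complex \<Rightarrow> complex \<Rightarrow> complex mat) \<Rightarrow> complex \<Rightarrow> complex Matrix.vec \<Rightarrow> vfun" where
  "kernel_section n D K w \<xi> =
     (\<lambda>z i. if z \<in> D \<and> i < n then vec_index (K z w *\<^sub>v \<xi>) i else 0)"

definition mult_z :: "vfun \<Rightarrow> vfun" where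
  "mult_z f = (\<lambda>z i. z * f z i)"

text \<open>\<open>\<Omega>\<^sup>*\<close>\<close>

definition conj_set :: "complex set \<Rightarrow> complex set" where
  "conj_set \<Omega> = {z. cnj z \<in> \<Omega>}"

text \<open>\<open>T = (M\<^sub>z\<^sup>*, H, K)\<close>. The last two clauses do not follow from the preceding ones: for
  \<open>H = z H\<^sup>2\<close> on the unit disc, with \<open>K z w = z * cnj w / (1 - z * cnj w)\<close>, both fail at \<open>w = 0\<close>, although
  \<open>M\<^sub>z\<^sup>*\<close> belongs to the Cowen-Douglas class of rank 1. They express that the kernel comes from a
  holomorphic frame of the eigenbundle.\<close>

definition kernel_realization ::
  "nat \<Rightarrow> complex set \<Rightarrow> vfun ip_space \<Rightarrow> (vfun \<Rightarrow> vfun) \<Rightarrow>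
   (complex \<Rightarrow> complex \<Rightarrow> complex mat) \<Rightarrow> bool" where
  "kernel_realization n \<Omega> H T K \<longleftrightarrow>
     (let D = conj_set \<Omega> in
      separable_hilbert_space H \<and>
      (\<forall>f\<in>hcarrier H. holo_vfun n D f) \<and>
      (\<forall>z\<in>D. \<forall>w\<in>D. K z w \<in> carrier_mat n n) \<and>
      (\<forall>w\<in>D. \<forall>i<n. \<forall>j<n. (\<lambda>z. K z w $$ (i, j)) holomorphic_on D) \<and>
      (\<forall>z\<in>D. \<forall>i<n. \<forall>j<n. (\<lambda>w. cnj (K z w $$ (i, j))) holomorphic_on D) \<and>
      (\<forall>w\<in>D. \<forall>\<xi>\<in>carrier_vec n.
         kernel_section n D K w \<xi> \<in> hcarrier H \<and>
         (\<forall>f\<in>hcarrier H. hinner H f (kernel_section n D K w \<xi>) = Matrix.vec n (f w) \<bullet>c \<xi>)) \<and>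
      bounded_op H mult_z \<and> bounded_op H T \<and>
      (\<forall>f\<in>hcarrier H. \<forall>g\<in>hcarrier H. hinner H (mult_z f) g = hinner H f (T g)) \<and>
      (\<forall>w\<in>D. eigenspace H T (cnj w) = kernel_section n D K w ` carrier_vec n) \<and>
      (\<forall>w\<in>D. \<forall>\<xi>\<in>carrier_vec n. \<xi> \<noteq> 0\<^sub>v n \<longrightarrow> 0 < (K w w *\<^sub>v \<xi>) \<bullet>c \<xi>))"

section \<open>Block matrices\<close>

text \<open>The \<open>(p, q)\<close> block of \<open>A\<close> when its rows and columns are cut into consecutive groups of sizes \<open>rs\<close>
  and \<open>cs\<close>. Sizes \<open>copies t m d\<close> give the blocks belonging to the individual summands; sizes \<open>m i * d i\<close> for
  \<open>i < t\<close> merge the \<open>m i\<close> consecutive blocks of size \<open>d i\<close> that belong to the copies of the \<open>i\<close>-th one.\<close>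

definition mat_block :: "nat list \<Rightarrow> nat list \<Rightarrow> 'x mat \<Rightarrow> nat \<Rightarrow> nat \<Rightarrow> 'x mat" where
  "mat_block rs cs A p q =
     mat (rs ! p) (cs ! q) (\<lambda>(a, b). A $$ (sum_list (take p rs) + a, sum_list (take q cs) + b))"

definition diag_kernel ::
  "(complex \<Rightarrow> complex \<Rightarrow> complex mat) list \<Rightarrow> complex \<Rightarrow> complex \<Rightarrow> complex mat" where
  "diag_kernel Ks z w = diag_block_mat (map (\<lambda>\<kappa>. \<kappa> z w) Ks)"

end

theory Submission
  imports Defs "Jordan_Normal_Form.Spectral_Radius"
begin

text \<open>Let \<open>\<Gamma>\<close> be the pointwise inverse of \<open>\<Phi>\<close>. The kernel equation says that multiplication by \<open>\<Phi>\<close> is a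
  unitary operator between the direct sums that intertwines the adjoints of multiplication by \<open>z\<close>. Cut it into blocks
  along the irreducible summands: multiplication by the block \<open>\<Phi>\<^sub>p\<^sub>q\<close> is a contraction \<open>X\<close> from the
  \<open>q\<close>-th summand on the right to the \<open>p\<close>-th one on the left, its adjoint \<open>Y\<close> is multiplication by
  \<open>\<Gamma>\<^sub>q\<^sub>p\<close>, and both intertwine the operators together with their adjoints. Hence \<open>Y X\<close> and \<open>X Y\<close> are
  self-adjoint operators commuting with irreducible operators and their adjoints, so they are scalars
  by Schur's lemma (\<open>irreducible_commutant_scalar\<close>). In the Cowen-Douglas setting this lemma is
  elementary: a commuting operator preserves the finite-dimensional eigenspaces
  \<open>{K(\<cdot>,\<lambda>)\<xi>}\<close>, hence has an eigenvector, and its eigenspaces are reducing.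

  If the scalar is zero, then \<open>X\<close> and \<open>\<Phi>\<^sub>p\<^sub>q\<close> vanish. If not, a multiple of \<open>X\<close> is a unitary
  equivalence of the two summands, and \<open>\<Gamma>\<^sub>q\<^sub>p(\<mu>)\<close> inverts \<open>\<Phi>\<^sub>p\<^sub>q(\<mu>)\<close> up to a factor
  (\<open>multiplier_dichotomy\<close>). As distinct summands of an (IR) decomposition are not unitarily equivalent,
  the second case occurs only in the groups \<open>(i, \<pi> i)\<close>; and these groups cannot vanish, as \<open>\<Phi>(\<mu>)\<close> would
  have zero rows.

  The operators \<open>X\<close> and \<open>Y\<close> are obtained without forming the direct sums. On kernel vectors \<open>X\<close> is given by
  \<open>K'\<^sub>q(\<cdot>,\<lambda>)\<eta> \<mapsto> K\<^sub>p(\<cdot>,\<lambda>) \<Gamma>\<^sub>q\<^sub>p(\<lambda>)\<^sup>* \<eta>\<close>; a Gram matrix computation bounds it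
  (\<open>multiplier_column_contraction\<close>), the kernel vectors at points of \<open>\<Lambda>\<close> are total by the identity
  theorem (\<open>kernel_frame_of_realization\<close>), and densely defined contractions extend
  (\<open>contraction_extension\<close>).\<close>

section \<open>Inner product spaces: norms, limits and density\<close>

definition hconv :: "'a::complex_vector ip_space \<Rightarrow> (nat \<Rightarrow> 'a) \<Rightarrow> 'a \<Rightarrow> bool" where
  "hconv H s x \<longleftrightarrow> (\<forall>n. s n \<in> hcarrier H) \<and> x \<in> hcarrier H \<and> (\<lambda>n. hnorm H (s n - x)) \<longlonglongrightarrow> 0"

context inner_product_space
begin

lemma hinner_diff_left:
  "\<lbrakk>x \<in> hcarrier H; y \<in> hcarrier H; z \<in> hcarrier H\<rbrakk>
    \<Longrightarrow> hinner H (x - y) z = hinner H x z - hinner H y z"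
  using hinner_add_left[of "x - y" y z] by (simp add: hcarrier_closed)

lemma hinner_diff_right:
  "\<lbrakk>x \<in> hcarrier H; y \<in> hcarrier H; z \<in> hcarrier H\<rbrakk>
    \<Longrightarrow> hinner H z (x - y) = hinner H z x - hinner H z y"
  using hinner_add_right[of "x - y" y z] by (simp add: hcarrier_closed)

lemma hinner_zero_right: "y \<in> hcarrier H \<Longrightarrow> hinner H y 0 = 0"
  using hinner_cnj[of 0 y] by (simp add: hinner_zero_left hcarrier_closed)

lemma hnorm_nonneg: "x \<in> hcarrier H \<Longrightarrow> 0 \<le> hnorm H x"
  by (simp add: hnorm_def hinner_nonneg)

lemma hnorm_zero: "hnorm H 0 = 0"
  by (simp add: hnorm_def hinner_zero_left hcarrier_closed)

lemma hnorm_eq_0: "x \<in> hcarrier H \<Longrightarrow> hnorm H x = 0 \<longleftrightarrow> x = 0"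
  using hinner_pos[of x] by (cases "x = 0") (auto simp: hnorm_def hinner_zero_left hcarrier_closed)

lemma hinner_self: "x \<in> hcarrier H \<Longrightarrow> hinner H x x = complex_of_real ((hnorm H x)\<^sup>2)"
  using hinner_cnj[of x x] by (simp add: hnorm_power2 complex_eq_iff)

lemma hnorm_scaleC:
  assumes "x \<in> hcarrier H" shows "hnorm H (a *\<^sub>C x) = cmod a * hnorm H x"
proof (rule power2_eq_imp_eq)
  have "complex_of_real ((hnorm H (a *\<^sub>C x))\<^sup>2) = a * cnj a * complex_of_real ((hnorm H x)\<^sup>2)"
    using assms hinner_self[of "a *\<^sub>C x"] hinner_self[of x]
    by (simp add: hcarrier_closed hinner_scaleC_left hinner_scaleC_right mult_ac)
  also have "\<dots> = complex_of_real ((cmod a * hnorm H x)\<^sup>2)"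
    by (metis complex_norm_square of_real_mult power_mult_distrib)
  finally show "(hnorm H (a *\<^sub>C x))\<^sup>2 = (cmod a * hnorm H x)\<^sup>2"
    using of_real_eq_iff by blast
qed (use assms in \<open>simp_all add: hnorm_nonneg hcarrier_closed\<close>)

lemma cmod_hinner_le:
  assumes x: "x \<in> hcarrier H" and y: "y \<in> hcarrier H"
  shows "cmod (hinner H x y) \<le> hnorm H x * hnorm H y"
proof (cases "hinner H x y = 0")
  case True
  then show ?thesis using x y by (simp add: hnorm_nonneg)
next
  case False
  \<comment> \<open>a unimodular factor makes the inner product real\<close>
  define u where "u = cnj (hinner H x y) / complex_of_real (cmod (hinner H x y))"
  have u: "cmod u = 1"
    using False by (simp add: u_def norm_divide)
  have "u * hinner H x y = complex_of_real (cmod (hinner H x y))"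
    using False complex_norm_square[of "hinner H x y"]
    by (simp add: u_def field_simps power2_eq_square)
  then have "cmod (hinner H x y) = Re (hinner H (u *\<^sub>C x) y)"
    using x y by (simp add: hinner_scaleC_left)
  also have "\<dots> \<le> hnorm H (u *\<^sub>C x) * hnorm H y"
    using x y by (intro Re_hinner_le) (auto simp: hcarrier_closed)
  finally show ?thesis
    using x by (simp add: hnorm_scaleC u)
qed

lemma parallelogram:
  assumes x: "x \<in> hcarrier H" and y: "y \<in> hcarrier H"
  shows "(hnorm H (x - y))\<^sup>2 + (hnorm H (x + y))\<^sup>2 = 2 * (hnorm H x)\<^sup>2 + 2 * (hnorm H y)\<^sup>2"
  using x y by (simp add: hnorm_power2 hcarrier_closed hinner_diff_left hinner_diff_right
      hinner_add_left hinner_add_right)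

lemma hnorm_diff_le:
  assumes "x \<in> hcarrier H" "y \<in> hcarrier H"
  shows "\<bar>hnorm H x - hnorm H y\<bar> \<le> hnorm H (x - y)"
  using assms hnorm_triangle[of "x - y" y] hnorm_triangle[of "y - x" x] hnorm_minus_commute[of x y]
  by (simp add: hcarrier_closed)

lemma hconvI_le:
  assumes "\<And>n. s n \<in> hcarrier H" "x \<in> hcarrier H" "\<And>n. hnorm H (s n - x) \<le> g n" "g \<longlonglongrightarrow> 0"
  shows "hconv H s x"
  unfolding hconv_def
proof (intro conjI allI)
  show "(\<lambda>n. hnorm H (s n - x)) \<longlonglongrightarrow> 0"
    using assms by (intro Lim_null_comparison[OF _ assms(4)] always_eventually)
      (simp add: hnorm_nonneg hcarrier_closed)
qed (use assms in auto)

lemma hconv_norm: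
  assumes "hconv H s x" shows "(\<lambda>n. hnorm H (s n)) \<longlonglongrightarrow> hnorm H x"
proof (rule LIM_zero_cancel, rule Lim_null_comparison)
  show "\<forall>\<^sub>F n in sequentially. norm (hnorm H (s n) - hnorm H x) \<le> hnorm H (s n - x)"
    using assms by (simp add: hconv_def hnorm_diff_le)
qed (use assms in \<open>simp add: hconv_def\<close>)

lemma hconv_hinner:
  assumes s: "hconv H s x" and y: "y \<in> hcarrier H"
  shows "(\<lambda>n. hinner H (s n) y) \<longlonglongrightarrow> hinner H x y"
proof (rule LIM_zero_cancel, rule Lim_null_comparison)
  have s': "\<And>n. s n \<in> hcarrier H" "x \<in> hcarrier H" "(\<lambda>n. hnorm H (s n - x)) \<longlonglongrightarrow> 0"
    using s by (auto simp: hconv_def)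
  have "norm (hinner H (s n) y - hinner H x y) \<le> hnorm H (s n - x) * hnorm H y" for n
    using cmod_hinner_le[of "s n - x" y] s' y by (simp add: hcarrier_closed hinner_diff_left)
  then show "\<forall>\<^sub>F n in sequentially. norm (hinner H (s n) y - hinner H x y) \<le> hnorm H (s n - x) * hnorm H y"
    by simp
  show "(\<lambda>n. hnorm H (s n - x) * hnorm H y) \<longlonglongrightarrow> 0"
    using tendsto_mult_left_zero[OF s'(3)] by simp
qed

lemma hconv_add:
  assumes "hconv H s x" "hconv H r y" shows "hconv H (\<lambda>n. s n + r n) (x + y)"
proof (rule hconvI_le)
  fix n
  have eq: "s n + r n - (x + y) = (s n - x) + (r n - y)" by simp
  show "hnorm H (s n + r n - (x + y)) \<le> hnorm H (s n - x) + hnorm H (r n - y)"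
    unfolding eq using assms hnorm_triangle[of "s n - x" "r n - y"] by (simp add: hconv_def hcarrier_closed)
next
  show "(\<lambda>n. hnorm H (s n - x) + hnorm H (r n - y)) \<longlonglongrightarrow> 0"
    using assms tendsto_add[of "\<lambda>n. hnorm H (s n - x)" 0 _ "\<lambda>n. hnorm H (r n - y)" 0]
    by (simp add: hconv_def)
qed (use assms in \<open>auto simp: hconv_def hcarrier_closed\<close>)

lemma hconv_scaleC:
  assumes "hconv H s x" shows "hconv H (\<lambda>n. a *\<^sub>C s n) (a *\<^sub>C x)"
proof (rule hconvI_le)
  fix n
  have "a *\<^sub>C s n - a *\<^sub>C x = a *\<^sub>C (s n - x)"
    by (simp add: complex_vector.scale_right_diff_distrib)
  then show "hnorm H (a *\<^sub>C s n - a *\<^sub>C x) \<le> cmod a * hnorm H (s n - x)"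
    using assms by (simp add: hconv_def hcarrier_closed hnorm_scaleC)
next
  show "(\<lambda>n. cmod a * hnorm H (s n - x)) \<longlonglongrightarrow> 0"
    using assms unfolding hconv_def by (intro tendsto_mult_right_zero) blast
qed (use assms in \<open>auto simp: hconv_def hcarrier_closed\<close>)

lemma subspace_horth:
  assumes "S \<subseteq> hcarrier H" shows "complex_vector.subspace (horth H S)"
  using assms by (intro complex_vector.subspaceI)
    (auto simp: horth_def hcarrier_closed hinner_add_left hinner_scaleC_left hinner_zero_left subset_iff)

lemma closedin_horth:
  assumes "S \<subseteq> hcarrier H" shows "closedin (htopology H) (horth H S)"
proof -
  interpret Metric_space "hcarrier H" "hdist H" by (rule Metric_space_hdist)
  have "l \<in> horth H S" if s: "range s \<subseteq> horth H S" "limitin mtopology s l sequentially" for s l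
  proof -
    have l: "l \<in> hcarrier H" "(\<lambda>n. hdist H (s n) l) \<longlonglongrightarrow> 0"
      using s(2) by (auto simp: limitin_metric_dist_null)
    have sn: "s n \<in> horth H S" for n using s(1) by auto
    then have "hconv H s l"
      using l by (simp add: hconv_def horth_def hdist_def)
    then have lim: "(\<lambda>n. hinner H (s n) y) \<longlonglongrightarrow> hinner H l y" if "y \<in> S" for y
      using that assms by (intro hconv_hinner) auto
    have "hinner H l y = 0" if "y \<in> S" for y
    proof (rule LIMSEQ_unique[OF lim[OF that]])
      show "(\<lambda>n. hinner H (s n) y) \<longlonglongrightarrow> 0"
        using sn that by (simp add: horth_def)
    qed
    then show ?thesis using l by (auto simp: horth_def)
  qed
  moreover have "horth H S \<subseteq> hcarrier H" by (auto simp: horth_def)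
  ultimately show ?thesis
    unfolding metric_closedin_iff_sequentially_closed by blast
qed

lemma horth_whole: "horth H (hcarrier H) = {0}"
  using hinner_pos by (force simp: horth_def hinner_zero_left hcarrier_closed)

end

context separable_hilbert_space
begin

lemma hconv_Cauchy:
  assumes s: "\<And>n. s n \<in> hcarrier H"
    and C: "\<And>e. 0 < e \<Longrightarrow> \<exists>N. \<forall>n\<ge>N. \<forall>n'\<ge>N. hnorm H (s n - s n') < e"
  shows "\<exists>x. hconv H s x"
proof -
  interpret Metric_space "hcarrier H" "hdist H" by (rule Metric_space_hdist)
  have "MCauchy s"
    using s C by (auto simp: MCauchy_def hdist_def)
  then obtain x where "limitin mtopology s x sequentially"
    using complete_hcarrier by (auto simp: mcomplete_def)
  then show ?thesis
    using s by (auto simp: limitin_metric_dist_null hconv_def hdist_def)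
qed

text \<open>The projection theorem in the form of a density criterion: a distance-minimizing sequence in
  \<open>V\<close> is Cauchy by the parallelogram law, and the difference of \<open>f\<close> and its limit is orthogonal
  to \<open>V\<close>.\<close>

lemma dense_if_horth_trivial:
  assumes V: "complex_vector.subspace V" "V \<subseteq> hcarrier H" and orth: "horth H V = {0}"
    and f: "f \<in> hcarrier H"
  shows "\<exists>s. (\<forall>n. s n \<in> V) \<and> hconv H s f"
proof -
  define D where "D = (INF v\<in>V. (hnorm H (f - v))\<^sup>2)"
  have V0: "0 \<in> V" using V(1) by (rule complex_vector.subspace_0)
  have bdd: "bdd_below ((\<lambda>v. (hnorm H (f - v))\<^sup>2) ` V)"
    by (rule bdd_belowI2[of _ 0]) simp
  have D_le: "D \<le> (hnorm H (f - v))\<^sup>2" if "v \<in> V" for v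
    unfolding D_def using bdd that by (rule cINF_lower)
  have "\<exists>v\<in>V. (hnorm H (f - v))\<^sup>2 < D + inverse (real (Suc n))" for n
  proof -
    have "(INF v\<in>V. (hnorm H (f - v))\<^sup>2) < D + inverse (real (Suc n))"
      by (simp add: D_def)
    then show ?thesis
      using cINF_less_iff[OF _ bdd] V0 by blast
  qed
  then obtain s where sV: "\<And>n. s n \<in> V"
    and s: "\<And>n. (hnorm H (f - s n))\<^sup>2 < D + inverse (real (Suc n))"
    by metis
  have sH: "s n \<in> hcarrier H" for n using sV V by auto
  have close: "(hnorm H (s n - s n'))\<^sup>2 \<le> 2 * inverse (real (Suc n)) + 2 * inverse (real (Suc n'))" for n n'
  proof -
    define v where "v = (1/2) *\<^sub>C (s n + s n')"
    have vV: "v \<in> V"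
      unfolding v_def using V(1) sV by (intro complex_vector.subspace_scale complex_vector.subspace_add)
    have e1: "(f - s n') + (f - s n) = 2 *\<^sub>C (f - v)"
    proof -
      have "2 *\<^sub>C v = s n + s n'" by (simp add: v_def)
      moreover have "2 *\<^sub>C f = f + f"
        using complex_vector.scale_left_distrib[of 1 1 f] by simp
      ultimately show ?thesis by (simp add: complex_vector.scale_right_diff_distrib)
    qed
    have e2: "(f - s n') - (f - s n) = s n - s n'" by simp
    have "(hnorm H (s n - s n'))\<^sup>2 + (hnorm H (2 *\<^sub>C (f - v)))\<^sup>2
        = 2 * (hnorm H (f - s n'))\<^sup>2 + 2 * (hnorm H (f - s n))\<^sup>2"
      using parallelogram[of "f - s n'" "f - s n"] sH f unfolding e1 e2 by (simp add: hcarrier_closed)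
    moreover have "(hnorm H (2 *\<^sub>C (f - v)))\<^sup>2 = 4 * (hnorm H (f - v))\<^sup>2"
      using f vV V by (subst hnorm_scaleC) (auto simp: hcarrier_closed power_mult_distrib)
    ultimately show ?thesis
      using D_le[OF vV] s[of n] s[of n'] by linarith
  qed
  obtain p where p: "hconv H s p"
  proof -
    have "\<exists>N. \<forall>n\<ge>N. \<forall>n'\<ge>N. hnorm H (s n - s n') < e" if e: "0 < e" for e
    proof -
      obtain N where N: "inverse (real (Suc N)) < e\<^sup>2 / 4"
        using reals_Archimedean[of "e\<^sup>2 / 4"] e by auto
      have "hnorm H (s n - s n') < e" if "n \<ge> N" "n' \<ge> N" for n n'
      proof (rule power2_less_imp_less)
        have "inverse (real (Suc n)) \<le> inverse (real (Suc N))"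
             "inverse (real (Suc n')) \<le> inverse (real (Suc N))"
          using that by (simp_all add: le_imp_inverse_le)
        then show "(hnorm H (s n - s n'))\<^sup>2 < e\<^sup>2"
          using close[of n n'] N by linarith
      qed (use e in simp)
      then show ?thesis by blast
    qed
    then have "\<exists>x. hconv H s x" by (intro hconv_Cauchy sH)
    then show ?thesis using that by blast
  qed
  define g where "g = f - p"
  have pH: "p \<in> hcarrier H" using p by (simp add: hconv_def)
  have gH: "g \<in> hcarrier H" using pH f by (simp add: g_def hcarrier_closed)
  have diff_conv: "hconv H (\<lambda>n. h - s n) (h - p)" if h: "h \<in> hcarrier H" for h
  proof (rule hconvI_le)
    fix n
    have eq: "h - s n - (h - p) = p - s n" by simp
    show "hnorm H (h - s n - (h - p)) \<le> hnorm H (s n - p)"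
      unfolding eq using hnorm_minus_commute[OF pH sH[of n]] by (rule eq_refl)
    show "h - s n \<in> hcarrier H" "h - p \<in> hcarrier H"
      using h pH sH by (simp_all add: hcarrier_closed)
    show "(\<lambda>n. hnorm H (s n - p)) \<longlonglongrightarrow> 0"
      using p unfolding hconv_def by blast
  qed
  have "(\<lambda>n. D + inverse (real (Suc n))) \<longlonglongrightarrow> D + 0"
    by (intro tendsto_add tendsto_const LIMSEQ_inverse_real_of_nat)
  moreover have "(\<lambda>n. (hnorm H (f - s n))\<^sup>2) \<longlonglongrightarrow> (hnorm H g)\<^sup>2"
    unfolding g_def by (intro tendsto_power hconv_norm diff_conv f)
  ultimately have gD: "(hnorm H g)\<^sup>2 \<le> D"
    using s by (intro LIMSEQ_le[of "\<lambda>n. (hnorm H (f - s n))\<^sup>2" _ "\<lambda>n. D + inverse (real (Suc n))" D])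
      (auto intro: less_imp_le)
  have "hinner H g v = 0" if v: "v \<in> V" for v
  proof -
    have vH: "v \<in> hcarrier H" using v V by auto
    define b where "b = (cmod (hinner H g v))\<^sup>2"
    \<comment> \<open>moving from \<open>g\<close> by a small multiple of its component along \<open>v\<close> would shorten it unless that
      component is zero\<close>
    define r where "r = inverse ((hnorm H v)\<^sup>2 + 1)"
    define a where "a = complex_of_real r * hinner H g v"
    have "(\<lambda>n. (hnorm H ((f - a *\<^sub>C v) - s n))\<^sup>2) \<longlonglongrightarrow> (hnorm H ((f - a *\<^sub>C v) - p))\<^sup>2"
      by (intro tendsto_power hconv_norm diff_conv) (auto simp: f vH hcarrier_closed)
    moreover have "D \<le> (hnorm H ((f - a *\<^sub>C v) - s n))\<^sup>2" for n
      using D_le[of "s n + a *\<^sub>C v"] V(1) v sV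
      by (simp add: complex_vector.subspace_add complex_vector.subspace_scale algebra_simps)
    ultimately have "D \<le> (hnorm H ((f - a *\<^sub>C v) - p))\<^sup>2"
      by (intro LIMSEQ_le_const) auto
    also have "(f - a *\<^sub>C v) - p = g - a *\<^sub>C v" by (simp add: g_def)
    also have "(hnorm H (g - a *\<^sub>C v))\<^sup>2 = (hnorm H g)\<^sup>2 - 2 * r * b + r\<^sup>2 * b * (hnorm H v)\<^sup>2"
    proof -
      have zz: "hinner H g v * cnj (hinner H g v) = complex_of_real b"
        unfolding b_def by (metis complex_norm_square of_real_power)
      have "complex_of_real ((hnorm H (g - a *\<^sub>C v))\<^sup>2) = hinner H (g - a *\<^sub>C v) (g - a *\<^sub>C v)"
        using gH vH by (simp only: hinner_self hcarrier_closed)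
      also have "\<dots> = hinner H g g - complex_of_real r * (hinner H g v * cnj (hinner H g v))
          - complex_of_real r * (hinner H g v * cnj (hinner H g v))
          + (complex_of_real r)\<^sup>2 * (hinner H g v * cnj (hinner H g v)) * hinner H v v"
        using gH vH by (simp add: a_def hcarrier_closed hinner_diff_left hinner_diff_right
            hinner_scaleC_left hinner_scaleC_right hinner_cnj[of g v] algebra_simps power2_eq_square)
      also have "\<dots> = complex_of_real ((hnorm H g)\<^sup>2 - 2 * r * b + r\<^sup>2 * b * (hnorm H v)\<^sup>2)"
        unfolding zz hinner_self[OF gH] hinner_self[OF vH] by (simp add: algebra_simps)
      finally show ?thesis using of_real_eq_iff by blast
    qed
    finally have "0 \<le> r * b * (r * (hnorm H v)\<^sup>2 - 2)"
      using gD by (simp add: algebra_simps power2_eq_square)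
    moreover have "0 < r" "r * (hnorm H v)\<^sup>2 < 2"
      by (simp_all add: r_def divide_simps add_nonneg_pos flip: divide_inverse)
    moreover have "0 \<le> b" by (simp add: b_def)
    ultimately have "b = 0"
      by (smt (verit) mult_pos_neg mult_pos_pos)
    then show ?thesis by (simp add: b_def)
  qed
  then have "g \<in> horth H V" using gH by (auto simp: horth_def)
  then have "f = p" using orth by (simp add: g_def)
  then show ?thesis using p sV by blast
qed

text \<open>The kernel of the functional is a subspace containing \<open>S\<close>, so it has trivial orthogonal
  complement and is dense. This is how identities between bounded operators are checked on kernel
  vectors only.\<close>

lemma bounded_functional_zero:
  assumes S: "S \<subseteq> hcarrier H" "horth H S = {0}"
    and add: "\<And>x y. \<lbrakk>x \<in> hcarrier H; y \<in> hcarrier H\<rbrakk> \<Longrightarrow> \<phi> (x + y) = \<phi> x + \<phi> y"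
    and scale: "\<And>a x. x \<in> hcarrier H \<Longrightarrow> \<phi> (a *\<^sub>C x) = a * \<phi> x"
    and bound: "\<And>x. x \<in> hcarrier H \<Longrightarrow> cmod (\<phi> x) \<le> C * hnorm H x"
    and zero: "\<And>x. x \<in> S \<Longrightarrow> \<phi> x = 0" and f: "f \<in> hcarrier H"
  shows "\<phi> f = (0 :: complex)"
proof -
  define V where "V = {x \<in> hcarrier H. \<phi> x = 0}"
  have "complex_vector.subspace V"
  proof (rule complex_vector.subspaceI)
    show "0 \<in> V" using scale[of 0 0] hcarrier_closed(1) by (simp add: V_def)
  qed (auto simp: V_def hcarrier_closed add scale)
  moreover have "horth H V = {0}"
  proof -
    have "S \<subseteq> V" using S zero by (auto simp: V_def)
    then have "horth H V \<subseteq> horth H S" by (auto simp: horth_def)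
    then show ?thesis
      using S hcarrier_closed(1) by (auto simp: V_def horth_def hinner_zero_left)
  qed
  ultimately obtain s where s: "\<And>n. s n \<in> V" "hconv H s f"
    using dense_if_horth_trivial[of V f] f by (auto simp: V_def)
  have le: "cmod (\<phi> f) \<le> C * hnorm H (s n - f)" for n
  proof -
    have sH: "s n \<in> hcarrier H" "\<phi> (s n) = 0" using s(1) by (auto simp: V_def)
    have "\<phi> (f - s n + s n) = \<phi> (f - s n) + \<phi> (s n)"
      using f sH by (intro add) (auto simp: hcarrier_closed)
    then have "\<phi> f = \<phi> (f - s n)" using sH by simp
    then show ?thesis
      using bound[of "f - s n"] f sH hnorm_minus_commute[of f "s n"] by (simp add: hcarrier_closed)
  qed
  have lim: "(\<lambda>n. C * hnorm H (s n - f)) \<longlonglongrightarrow> 0"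
    using s(2) unfolding hconv_def by (intro tendsto_mult_right_zero) blast
  have "cmod (\<phi> f) \<le> 0"
    by (rule LIMSEQ_le_const[OF lim]) (simp add: le)
  then show ?thesis by simp
qed

end

section \<open>Extension of densely defined contractions\<close>

text \<open>\<open>G\<close> is the graph of a map defined on a dense subspace. The norm bound makes images of Cauchy
  sequences Cauchy, so the closure \<open>E\<close> of \<open>G\<close> has full domain; applied to differences it makes \<open>E\<close>
  single-valued. A relation is used instead of a map because for kernel vectors, which may be linearly
  dependent, only the norm bound shows that the assignment is well defined.\<close>

lemma contraction_extension:
  fixes H :: "'a::complex_vector ip_space" and H' :: "'b::complex_vector ip_space"
  assumes H: "separable_hilbert_space H" and H': "separable_hilbert_space H'"
    and G: "G \<subseteq> hcarrier H \<times> hcarrier H'"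
    and zero: "(0, 0) \<in> G"
    and add: "\<And>x y x' y'. \<lbrakk>(x, y) \<in> G; (x', y') \<in> G\<rbrakk> \<Longrightarrow> (x + x', y + y') \<in> G"
    and scale: "\<And>a x y. (x, y) \<in> G \<Longrightarrow> (a *\<^sub>C x, a *\<^sub>C y) \<in> G"
    and contr: "\<And>x y. (x, y) \<in> G \<Longrightarrow> hnorm H' y \<le> hnorm H x"
    and total: "horth H (fst ` G) = {0}"
  shows "\<exists>X. linear_op H H' X \<and> (\<forall>x\<in>hcarrier H. hnorm H' (X x) \<le> hnorm H x) \<and>
    (\<forall>(x, y)\<in>G. X x = y)"
proof -
  interpret H: separable_hilbert_space H by fact
  interpret H': separable_hilbert_space H' by fact
  define E where "E f h \<longleftrightarrow> (\<exists>s r. (\<forall>i. (s i, r i) \<in> G) \<and> hconv H s f \<and> hconv H' r h)" for f h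
  have G_in: "x \<in> hcarrier H" "y \<in> hcarrier H'" if "(x, y) \<in> G" for x y
    using G that by auto
  have G_diff: "(x - x', y - y') \<in> G" if "(x, y) \<in> G" "(x', y') \<in> G" for x y x' y'
    using add[OF that(1) scale[OF that(2), of "-1"]] by simp
  have E_in: "f \<in> hcarrier H" "h \<in> hcarrier H'" if "E f h" for f h
    using that by (auto simp: E_def hconv_def)
  have E_ex: "\<exists>h. E f h" if f: "f \<in> hcarrier H" for f
  proof -
    have "complex_vector.subspace (fst ` G)"
    proof (rule complex_vector.subspaceI)
      show "0 \<in> fst ` G" using zero by force
      show "x + y \<in> fst ` G" if "x \<in> fst ` G" "y \<in> fst ` G" for x y
        using that add by force
      show "a *\<^sub>C x \<in> fst ` G" if "x \<in> fst ` G" for a x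
        using that scale by force
    qed
    moreover have "fst ` G \<subseteq> hcarrier H" using G by auto
    ultimately obtain s where s: "\<And>i. s i \<in> fst ` G" "hconv H s f"
      using H.dense_if_horth_trivial[OF _ _ total f] by blast
    have "\<forall>i. \<exists>y. (s i, y) \<in> G" using s(1) by force
    then obtain r where r: "\<And>i. (s i, r i) \<in> G" by metis
    have sH: "s i \<in> hcarrier H" and rH: "r i \<in> hcarrier H'" for i
      using G_in[OF r] by auto
    have fin: "f \<in> hcarrier H" using f .
    have "\<exists>N. \<forall>i\<ge>N. \<forall>j\<ge>N. hnorm H' (r i - r j) < e" if e: "0 < e" for e
    proof -
      have "(\<lambda>i. hnorm H (s i - f)) \<longlonglongrightarrow> 0" using s(2) by (simp add: hconv_def)
      then obtain N where N: "\<And>i. i \<ge> N \<Longrightarrow> hnorm H (s i - f) < e / 2"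
        using e LIMSEQ_D[of "\<lambda>i. hnorm H (s i - f)" 0 "e / 2"] H.hnorm_nonneg sH fin
        by (auto simp: H.hcarrier_closed)
      have "hnorm H' (r i - r j) < e" if ij: "i \<ge> N" "j \<ge> N" for i j
      proof -
        have "hnorm H' (r i - r j) \<le> hnorm H ((s i - f) + (f - s j))"
          using contr[OF G_diff[OF r r]] by simp
        also have "\<dots> \<le> hnorm H (s i - f) + hnorm H (f - s j)"
          by (intro H.hnorm_triangle H.hcarrier_closed sH fin)
        also have "hnorm H (f - s j) = hnorm H (s j - f)"
          by (intro H.hnorm_minus_commute sH fin)
        finally show ?thesis using N[OF ij(1)] N[OF ij(2)] by linarith
      qed
      then show ?thesis by blast
    qed
    then have "\<exists>h. hconv H' r h" by (intro H'.hconv_Cauchy rH)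
    then show ?thesis using s r unfolding E_def by blast
  qed
  have E_le: "hnorm H' h \<le> hnorm H f" if "E f h" for f h
  proof -
    obtain s r where sr: "\<And>i. (s i, r i) \<in> G" "hconv H s f" "hconv H' r h"
      using \<open>E f h\<close> by (auto simp: E_def)
    show ?thesis
      by (rule LIMSEQ_le[OF H'.hconv_norm[OF sr(3)] H.hconv_norm[OF sr(2)]]) (use contr sr in blast)
  qed
  have E_add: "E (f + f') (h + h')" if fh: "E f h" "E f' h'" for f f' h h'
  proof -
    obtain s r where sr: "\<And>i. (s i, r i) \<in> G" "hconv H s f" "hconv H' r h"
      using \<open>E f h\<close> by (auto simp: E_def)
    obtain s' r' where sr': "\<And>i. (s' i, r' i) \<in> G" "hconv H s' f'" "hconv H' r' h'"
      using \<open>E f' h'\<close> by (auto simp: E_def)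
    show ?thesis unfolding E_def
      using add[OF sr(1) sr'(1)] H.hconv_add[OF sr(2) sr'(2)] H'.hconv_add[OF sr(3) sr'(3)]
      by (intro exI[of _ "\<lambda>i. s i + s' i"] exI[of _ "\<lambda>i. r i + r' i"] conjI allI)
  qed
  have E_scale: "E (a *\<^sub>C f) (a *\<^sub>C h)" if fh: "E f h" for a f h
  proof -
    obtain s r where sr: "\<And>i. (s i, r i) \<in> G" "hconv H s f" "hconv H' r h"
      using \<open>E f h\<close> by (auto simp: E_def)
    show ?thesis unfolding E_def
      using scale[OF sr(1)] H.hconv_scaleC[OF sr(2)] H'.hconv_scaleC[OF sr(3)]
      by (intro exI[of _ "\<lambda>i. a *\<^sub>C s i"] exI[of _ "\<lambda>i. a *\<^sub>C r i"] conjI allI)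
  qed
  have E_unique: "h = h'" if "E f h" "E f h'" for f h h'
  proof -
    have "E 0 (h - h')"
      using E_add[OF that(1) E_scale[OF that(2), of "-1"]] by simp
    then have "hnorm H' (h - h') \<le> 0" using E_le H.hnorm_zero by fastforce
    then have "hnorm H' (h - h') = 0"
      using H'.hnorm_nonneg[of "h - h'"] E_in that by (simp add: H'.hcarrier_closed)
    then show ?thesis
      using H'.hnorm_eq_0[of "h - h'"] E_in that by (simp add: H'.hcarrier_closed)
  qed
  have E_G: "E x y" if "(x, y) \<in> G" for x y
    unfolding E_def using that G_in[OF that]
    by (intro exI[of _ "\<lambda>i. x"] exI[of _ "\<lambda>i. y"]) (simp add: hconv_def H.hnorm_zero H'.hnorm_zero)
  define X where "X f = (THE h. E f h)" for f
  have X_eq: "X f = h" if "E f h" for f h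
    unfolding X_def using that E_unique by blast
  have X: "E f (X f)" if "f \<in> hcarrier H" for f
    using E_ex[OF that] X_eq by metis
  have "linear_op H H' X"
    unfolding linear_op_def using X E_in E_add E_scale X_eq by metis
  moreover have "hnorm H' (X x) \<le> hnorm H x" if "x \<in> hcarrier H" for x
    using E_le[OF X[OF that]] .
  moreover have "X x = y" if "(x, y) \<in> G" for x y
    using X_eq[OF E_G[OF that]] .
  ultimately show ?thesis by blast
qed

section \<open>Irreducible operators\<close>

text \<open>Schur's lemma. A self-adjoint \<open>A\<close> commuting with \<open>T\<close> and its adjoint \<open>S\<close> has reducing eigenspaces:
  each is closed, being the orthogonal complement of the range of \<open>A - cnj c\<close>, and invariant under both
  operators. So a single eigenvector suffices: by irreducibility its eigenspace is the whole space.\<close>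

lemma (in inner_product_space) irreducible_commutant_scalar:
  assumes irr: "irreducible_op H T"
    and T: "linear_op H H T" and S: "linear_op H H S"
    and adj: "\<And>f g. \<lbrakk>f \<in> hcarrier H; g \<in> hcarrier H\<rbrakk> \<Longrightarrow> hinner H (S f) g = hinner H f (T g)"
    and A: "linear_op H H A"
    and self: "\<And>f g. \<lbrakk>f \<in> hcarrier H; g \<in> hcarrier H\<rbrakk> \<Longrightarrow> hinner H (A f) g = hinner H f (A g)"
    and AT: "\<And>f. f \<in> hcarrier H \<Longrightarrow> A (T f) = T (A f)"
    and AS: "\<And>f. f \<in> hcarrier H \<Longrightarrow> A (S f) = S (A f)"
    and x: "x \<in> hcarrier H" "x \<noteq> 0" "A x = c *\<^sub>C x"
    and f: "f \<in> hcarrier H"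
  shows "A f = c *\<^sub>C f"
proof -
  define M where "M = {f \<in> hcarrier H. A f = c *\<^sub>C f}"
  define R where "R = (\<lambda>g. A g - cnj c *\<^sub>C g) ` hcarrier H"
  have A_in: "A g \<in> hcarrier H" and T_in: "T g \<in> hcarrier H" and S_in: "S g \<in> hcarrier H"
    if "g \<in> hcarrier H" for g
    using A T S that by (auto simp: linear_op_def)
  have R: "R \<subseteq> hcarrier H" using A_in by (auto simp: R_def hcarrier_closed)
  have pair: "hinner H f (A g - cnj c *\<^sub>C g) = hinner H (A f - c *\<^sub>C f) g"
    if "f \<in> hcarrier H" "g \<in> hcarrier H" for f g
    using that A_in self by (simp add: hinner_diff_left hinner_diff_right hinner_scaleC_left
        hinner_scaleC_right hcarrier_closed)
  have "M = horth H R"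
  proof (intro equalityI subsetI)
    fix f assume "f \<in> M"
    then show "f \<in> horth H R"
      using pair[of f] by (auto simp: M_def horth_def R_def hinner_zero_left)
  next
    fix f assume f: "f \<in> horth H R"
    then have fH: "f \<in> hcarrier H" by (simp add: horth_def)
    have "A f - c *\<^sub>C f \<in> horth H (hcarrier H)"
      using f pair[OF fH] A_in[OF fH] fH by (auto simp: horth_def R_def hcarrier_closed)
    then show "f \<in> M" using fH by (simp add: horth_whole M_def)
  qed
  moreover have "T f \<in> M" if "f \<in> M" for f
    using that AT T T_in by (auto simp: M_def linear_op_def)
  moreover have "T f \<in> horth H M" if f: "f \<in> horth H M" for f
  proof -
    have fH: "f \<in> hcarrier H" using f by (simp add: horth_def)
    have "hinner H (T f) g = 0" if g: "g \<in> M" for g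
    proof -
      have gH: "g \<in> hcarrier H" using g by (simp add: M_def)
      have "S g \<in> M" using g AS S S_in by (auto simp: M_def linear_op_def)
      then have "hinner H f (S g) = 0" using f by (simp add: horth_def)
      then show ?thesis
        using adj[OF gH fH] hinner_cnj[OF fH S_in[OF gH]] hinner_cnj[OF gH T_in[OF fH]] by simp
    qed
    then show ?thesis using T_in[OF fH] by (simp add: horth_def)
  qed
  ultimately have "reducing_subspace H T M"
    unfolding reducing_subspace_def using closedin_horth[OF R] subspace_horth[OF R] by auto
  moreover have "M \<noteq> {0}" using x by (auto simp: M_def)
  ultimately have "M = hcarrier H" using irr by (auto simp: irreducible_op_def)
  then show ?thesis using f by (auto simp: M_def)
qed

section \<open>Adjoint matrices\<close>

lemma dim_mat_adjoint [simp]: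
  "dim_row (mat_adjoint A) = dim_col A" "dim_col (mat_adjoint A) = dim_row A"
  by (simp_all add: mat_adjoint_def mat_of_rows_def)

lemma mat_adjoint_carrier [simp]:
  "A \<in> carrier_mat r c \<Longrightarrow> mat_adjoint A \<in> carrier_mat c r"
  by (intro carrier_matI) simp_all

lemma index_mat_adjoint [simp]:
  "\<lbrakk>i < dim_col A; j < dim_row A\<rbrakk> \<Longrightarrow> mat_adjoint A $$ (i, j) = cnj (A $$ (j, i))"
  for A :: "complex mat"
  by (simp add: mat_adjoint_def mat_of_rows_def)

lemma mat_adjoint_involutive [simp]: "mat_adjoint (mat_adjoint A) = (A :: complex mat)"
  by (rule eq_matI) auto

lemma mat_adjoint_mult:
  assumes "A \<in> carrier_mat r s" "B \<in> carrier_mat s c"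
  shows "mat_adjoint (A * B) = mat_adjoint B * mat_adjoint (A :: complex mat)"
  using assms by (intro eq_matI) (auto simp: scalar_prod_def mult.commute intro!: sum.cong)

lemma cscalar_prod_mult_mat_vec:
  fixes A :: "complex mat"
  assumes "A \<in> carrier_mat r c" "v \<in> carrier_vec c" "w \<in> carrier_vec r"
  shows "(A *\<^sub>v v) \<bullet>c w = (\<Sum>i<r. \<Sum>j<c. A $$ (i, j) * vec_index v j * cnj (vec_index w i))"
  using assms by (auto simp: scalar_prod_def sum_distrib_right atLeast0LessThan intro!: sum.cong)

lemma cscalar_prod_mat_adjoint:
  fixes A :: "complex mat"
  assumes "A \<in> carrier_mat r c" "v \<in> carrier_vec c" "w \<in> carrier_vec r"
  shows "(A *\<^sub>v v) \<bullet>c w = v \<bullet>c (mat_adjoint A *\<^sub>v w)"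
proof -
  have "v \<bullet>c (mat_adjoint A *\<^sub>v w) = (\<Sum>j<c. \<Sum>i<r. A $$ (i, j) * vec_index v j * cnj (vec_index w i))"
    using assms by (auto simp: scalar_prod_def sum_distrib_left atLeast0LessThan mult_ac intro!: sum.cong)
  also have "\<dots> = (A *\<^sub>v v) \<bullet>c w"
    unfolding cscalar_prod_mult_mat_vec[OF assms] by (rule sum.swap)
  finally show ?thesis by simp
qed

lemma mat_eq_scalar_one_if_mult_vec:
  fixes A :: "complex mat"
  assumes "A \<in> carrier_mat n n" "\<And>v. v \<in> carrier_vec n \<Longrightarrow> A *\<^sub>v v = c \<cdot>\<^sub>v v"
  shows "A = c \<cdot>\<^sub>m 1\<^sub>m n"
proof (rule eq_matI)
  fix i j assume ij: "i < dim_row (c \<cdot>\<^sub>m 1\<^sub>m n)" "j < dim_col (c \<cdot>\<^sub>m 1\<^sub>m n)"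
  have "A $$ (i, j) = vec_index (A *\<^sub>v unit_vec n j) i"
    using assms(1) ij by (auto simp: scalar_prod_right_unit)
  also have "\<dots> = (c \<cdot>\<^sub>m 1\<^sub>m n) $$ (i, j)"
    using assms(2)[of "unit_vec n j"] ij by (auto simp: unit_vec_def)
  finally show "A $$ (i, j) = (c \<cdot>\<^sub>m 1\<^sub>m n) $$ (i, j)" .
qed (use assms in auto)

lemma eigenvector_ex:
  fixes A :: "complex mat"
  assumes "A \<in> carrier_mat n n" "0 < n"
  obtains v c where "v \<in> carrier_vec n" "v \<noteq> 0\<^sub>v n" "A *\<^sub>v v = c \<cdot>\<^sub>v v"
  using spectrum_non_empty[OF assms] assms
  by (auto simp: spectrum_def eigenvalue_def eigenvector_def)

text \<open>Equality of the traces of \<open>A B\<close> and \<open>B A\<close> forces \<open>A\<close> to be square.\<close>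

lemma invertible_mat_if_scalar_products:
  fixes A B :: "complex mat"
  assumes A: "A \<in> carrier_mat r s" and B: "B \<in> carrier_mat s r" and c: "c \<noteq> 0"
    and AB: "A * B = c \<cdot>\<^sub>m 1\<^sub>m r" and BA: "B * A = c \<cdot>\<^sub>m 1\<^sub>m s"
  shows "invertible_mat A"
proof -
  have "c * of_nat r = (\<Sum>i<r. (A * B) $$ (i, i))" by (simp add: AB)
  also have "\<dots> = (\<Sum>i<r. \<Sum>j<s. A $$ (i, j) * B $$ (j, i))"
    using A B by (auto simp: scalar_prod_def atLeast0LessThan intro!: sum.cong)
  also have "\<dots> = (\<Sum>j<s. \<Sum>i<r. B $$ (j, i) * A $$ (i, j))"
    by (subst sum.swap) (simp add: mult.commute)
  also have "\<dots> = (\<Sum>j<s. (B * A) $$ (j, j))"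
    using A B by (auto simp: scalar_prod_def atLeast0LessThan intro!: sum.cong)
  also have "\<dots> = c * of_nat s" by (simp add: BA)
  finally have rs: "r = s" using c by simp
  have "A * (inverse c \<cdot>\<^sub>m B) = 1\<^sub>m r" "(inverse c \<cdot>\<^sub>m B) * A = 1\<^sub>m s"
    using A B AB BA c by (auto simp: mult_smult_distrib mult_smult_assoc_mat)
  then show ?thesis
    using A B rs by (auto simp: invertible_mat_def inverts_mat_def square_mat.simps)
qed

section \<open>Hilbert spaces spanned by kernel vectors\<close>

definition frame_set :: "nat \<Rightarrow> complex set \<Rightarrow> (complex \<Rightarrow> complex Matrix.vec \<Rightarrow> 'a) \<Rightarrow> 'a set" where
  "frame_set n \<Lambda> k = {k z v |z v. z \<in> \<Lambda> \<and> v \<in> carrier_vec n}"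

text \<open>What the argument uses of \<open>T = (M\<^sub>z\<^sup>*, H, K)\<close>, restricted to an open set \<open>\<Lambda>\<close> and with function
  values forgotten: eigenvectors \<open>k z v\<close> of \<open>T\<close>, linear in \<open>v\<close>, whose Gram matrix is the kernel, and
  which are total already for \<open>z \<in> \<Lambda>\<close>. Here \<open>S\<close> stands for multiplication by \<open>z\<close>.\<close>

locale kernel_frame = separable_hilbert_space H
  for H :: "'a::complex_vector ip_space" +
  fixes n :: nat and \<Lambda> :: "complex set" and T S :: "'a \<Rightarrow> 'a"
    and K :: "complex \<Rightarrow> complex \<Rightarrow> complex mat" and k :: "complex \<Rightarrow> complex Matrix.vec \<Rightarrow> 'a"
  assumes n_pos: "0 < n" and \<Lambda>_nonempty: "\<Lambda> \<noteq> {}"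
    and T_linear: "linear_op H H T" and S_linear: "linear_op H H S"
    and adj: "\<lbrakk>f \<in> hcarrier H; g \<in> hcarrier H\<rbrakk> \<Longrightarrow> hinner H (S f) g = hinner H f (T g)"
    and K_carrier: "\<lbrakk>z \<in> \<Lambda>; w \<in> \<Lambda>\<rbrakk> \<Longrightarrow> K z w \<in> carrier_mat n n"
    and k_in: "\<lbrakk>z \<in> \<Lambda>; v \<in> carrier_vec n\<rbrakk> \<Longrightarrow> k z v \<in> hcarrier H"
    and k_add: "\<lbrakk>z \<in> \<Lambda>; u \<in> carrier_vec n; v \<in> carrier_vec n\<rbrakk> \<Longrightarrow> k z (u + v) = k z u + k z v"
    and k_scale: "\<lbrakk>z \<in> \<Lambda>; v \<in> carrier_vec n\<rbrakk> \<Longrightarrow> k z (a \<cdot>\<^sub>v v) = a *\<^sub>C k z v"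
    and k_nonzero: "\<lbrakk>z \<in> \<Lambda>; v \<in> carrier_vec n; v \<noteq> 0\<^sub>v n\<rbrakk> \<Longrightarrow> k z v \<noteq> 0"
    and T_k: "\<lbrakk>z \<in> \<Lambda>; v \<in> carrier_vec n\<rbrakk> \<Longrightarrow> T (k z v) = cnj z *\<^sub>C k z v"
    and gram: "\<lbrakk>z \<in> \<Lambda>; w \<in> \<Lambda>; u \<in> carrier_vec n; v \<in> carrier_vec n\<rbrakk>
      \<Longrightarrow> hinner H (k w u) (k z v) = (K z w *\<^sub>v u) \<bullet>c v"
    and total: "horth H (frame_set n \<Lambda> k) = {0}"
begin

lemma frame_set_sub: "frame_set n \<Lambda> k \<subseteq> hcarrier H"
  using k_in by (auto simp: frame_set_def)

lemma k_inj:
  assumes "z \<in> \<Lambda>" "u \<in> carrier_vec n" "v \<in> carrier_vec n" "k z u = k z v"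
  shows "u = v"
proof -
  have "k z (u + (-1) \<cdot>\<^sub>v v) = 0"
    using assms by (subst k_add) (auto simp: k_scale)
  then have uv: "u + (-1) \<cdot>\<^sub>v v = 0\<^sub>v n"
    using assms k_nonzero[of z "u + (-1) \<cdot>\<^sub>v v"] by auto
  have "vec_index u i = vec_index v i" if "i < n" for i
  proof -
    have "vec_index (u + (-1) \<cdot>\<^sub>v v) i = vec_index (0\<^sub>v n) i" by (simp only: uv)
    then show ?thesis using assms that by simp
  qed
  then show ?thesis using assms by (intro eq_vecI) auto
qed

lemma eq_if_hinner_k:
  assumes "f \<in> hcarrier H" "g \<in> hcarrier H"
    and "\<And>z v. \<lbrakk>z \<in> \<Lambda>; v \<in> carrier_vec n\<rbrakk> \<Longrightarrow> hinner H f (k z v) = hinner H g (k z v)"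
  shows "f = g"
proof -
  have "f - g \<in> horth H (frame_set n \<Lambda> k)"
    using assms k_in by (auto simp: horth_def frame_set_def hcarrier_closed hinner_diff_left)
  then show ?thesis using total by simp
qed

lemma S_k:
  assumes "f \<in> hcarrier H" "z \<in> \<Lambda>" "v \<in> carrier_vec n"
  shows "hinner H (S f) (k z v) = z * hinner H f (k z v)"
  using assms by (simp add: adj k_in T_k hinner_scaleC_right)

lemma combo_in:
  "set L \<subseteq> \<Lambda> \<times> carrier_vec n \<Longrightarrow> (\<Sum>(z, v)\<leftarrow>L. k z v) \<in> hcarrier H"
  by (induction L) (auto simp: hcarrier_closed k_in)

end

lemma sum_list_pair_scaleC:
  "(\<Sum>(z, v)\<leftarrow>L. a *\<^sub>C f z v) = a *\<^sub>C (\<Sum>(z, v)\<leftarrow>L. f z v :: 'a::complex_vector)"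
  by (induction L) (auto simp: complex_vector.scale_right_distrib)

locale frame_pair = F: kernel_frame H n \<Lambda> T S K k + F': kernel_frame H' n' \<Lambda> T' S' K' k'
  for H :: "'a::complex_vector ip_space" and n \<Lambda> T S K k
    and H' :: "'b::complex_vector ip_space" and n' T' S' K' k'
begin

text \<open>The assignment on kernel vectors extends to finite sums, where the norm bound makes it well
  defined, and then by continuity to the whole space.\<close>

lemma frame_contraction:
  assumes A: "\<And>z. z \<in> \<Lambda> \<Longrightarrow> A z \<in> carrier_mat n n'"
    and contr: "\<And>L. set L \<subseteq> \<Lambda> \<times> carrier_vec n' \<Longrightarrow>
      hnorm H (\<Sum>(z, v)\<leftarrow>L. k z (A z *\<^sub>v v)) \<le> hnorm H' (\<Sum>(z, v)\<leftarrow>L. k' z v)"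
  shows "\<exists>X. linear_op H' H X \<and> (\<forall>f\<in>hcarrier H'. hnorm H (X f) \<le> hnorm H' f) \<and>
    (\<forall>z\<in>\<Lambda>. \<forall>v\<in>carrier_vec n'. X (k' z v) = k z (A z *\<^sub>v v))"
proof -
  define P where "P L = (\<Sum>(z, v)\<leftarrow>L. k' z v, \<Sum>(z, v)\<leftarrow>L. k z (A z *\<^sub>v v))" for L
  define G where "G = P ` {L. set L \<subseteq> \<Lambda> \<times> carrier_vec n'}"
  have A_in: "A z *\<^sub>v v \<in> carrier_vec n" if "z \<in> \<Lambda>" "v \<in> carrier_vec n'" for z v
    using A[OF that(1)] that(2) by simp
  have "(\<Sum>(z, v)\<leftarrow>L. k z (A z *\<^sub>v v)) \<in> hcarrier H" if "set L \<subseteq> \<Lambda> \<times> carrier_vec n'" for L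
    using that A_in by (induction L) (auto simp: F.hcarrier_closed F.k_in)
  then have G: "G \<subseteq> hcarrier H' \<times> hcarrier H"
    using F'.combo_in by (auto simp: G_def P_def)
  have P: "P L \<in> G" if "set L \<subseteq> \<Lambda> \<times> carrier_vec n'" for L
    using that by (auto simp: G_def)
  have single: "(k' z v, k z (A z *\<^sub>v v)) \<in> G" if "z \<in> \<Lambda>" "v \<in> carrier_vec n'" for z v
    using P[of "[(z, v)]"] that by (simp add: P_def)
  have "\<exists>X. linear_op H' H X \<and> (\<forall>f\<in>hcarrier H'. hnorm H (X f) \<le> hnorm H' f) \<and>
    (\<forall>(x, y)\<in>G. X x = y)"
  proof (rule contraction_extension[OF F'.separable_hilbert_space_axioms F.separable_hilbert_space_axioms G])
    show "(0, 0) \<in> G" using P[of "[]"] by (simp add: P_def)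
    show "(x + x', y + y') \<in> G" if xy: "(x, y) \<in> G" "(x', y') \<in> G" for x y x' y'
    proof -
      obtain L L' where L: "set L \<subseteq> \<Lambda> \<times> carrier_vec n'" "set L' \<subseteq> \<Lambda> \<times> carrier_vec n'"
        and eq: "(x, y) = P L" "(x', y') = P L'"
        using xy unfolding G_def by blast
      have "(x + x', y + y') = P (L @ L')" using eq by (simp add: P_def)
      then show ?thesis using P[of "L @ L'"] L by simp
    qed
    show "(a *\<^sub>C x, a *\<^sub>C y) \<in> G" if xy: "(x, y) \<in> G" for a x y
    proof -
      obtain L where L: "set L \<subseteq> \<Lambda> \<times> carrier_vec n'" and eq: "(x, y) = P L"
        using xy unfolding G_def by blast
      let ?L = "map (\<lambda>(z, v). (z, a \<cdot>\<^sub>v v)) L"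
      have mem: "z \<in> \<Lambda>" "v \<in> carrier_vec n'" if "(z, v) \<in> set L" for z v
        using L that by auto
      have "(\<Sum>(z, v)\<leftarrow>?L. k' z v) = (\<Sum>(z, v)\<leftarrow>L. a *\<^sub>C k' z v)"
        using mem F'.k_scale by (auto simp: comp_def intro!: arg_cong[where f = sum_list])
      moreover have "(\<Sum>(z, v)\<leftarrow>?L. k z (A z *\<^sub>v v)) = (\<Sum>(z, v)\<leftarrow>L. a *\<^sub>C k z (A z *\<^sub>v v))"
      proof -
        have "A z *\<^sub>v (a \<cdot>\<^sub>v v) = a \<cdot>\<^sub>v (A z *\<^sub>v v)" if "(z, v) \<in> set L" for z v
          using mem[OF that] A by (intro mult_mat_vec) auto
        then show ?thesis
          using mem A_in F.k_scale by (auto simp: comp_def intro!: arg_cong[where f = sum_list])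
      qed
      ultimately have "(a *\<^sub>C x, a *\<^sub>C y) = P ?L"
        using eq by (simp add: P_def sum_list_pair_scaleC)
      moreover have "set ?L \<subseteq> \<Lambda> \<times> carrier_vec n'" using L by auto
      ultimately show ?thesis using P by simp
    qed
    show "hnorm H y \<le> hnorm H' x" if "(x, y) \<in> G" for x y
      using that contr by (auto simp: G_def P_def)
    show "horth H' (fst ` G) = {0}"
    proof -
      have "frame_set n' \<Lambda> k' \<subseteq> fst ` G"
        using single by (force simp: frame_set_def)
      then have "horth H' (fst ` G) \<subseteq> horth H' (frame_set n' \<Lambda> k')"
        unfolding horth_def by blast
      then have "horth H' (fst ` G) \<subseteq> {0}" using F'.total by simp
      moreover have "0 \<in> horth H' (fst ` G)"
        using G F'.hcarrier_closed(1) by (auto simp: horth_def F'.hinner_zero_left)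
      ultimately show ?thesis by blast
    qed
  qed
  then obtain X where X: "linear_op H' H X" "\<forall>f\<in>hcarrier H'. hnorm H (X f) \<le> hnorm H' f"
    and XG: "\<forall>(x, y)\<in>G. X x = y" by blast
  have "X (k' z v) = k z (A z *\<^sub>v v)" if "z \<in> \<Lambda>" "v \<in> carrier_vec n'" for z v
    using bspec[OF XG single[OF that]] by simp
  then show ?thesis using X by blast
qed

text \<open>Both sides are bounded and additive in each argument, so totality of the kernel vectors is used
  once in \<open>f\<close> and once in \<open>g\<close>.\<close>

lemma adjoint_if_adjoint_on_frames:
  assumes X: "linear_op H' H X" "\<And>f. f \<in> hcarrier H' \<Longrightarrow> hnorm H (X f) \<le> hnorm H' f"
    and Y: "linear_op H H' Y" "\<And>g. g \<in> hcarrier H \<Longrightarrow> hnorm H' (Y g) \<le> hnorm H g"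
    and frames: "\<And>z w u v. \<lbrakk>z \<in> \<Lambda>; w \<in> \<Lambda>; u \<in> carrier_vec n; v \<in> carrier_vec n'\<rbrakk>
      \<Longrightarrow> hinner H (X (k' w v)) (k z u) = hinner H' (k' w v) (Y (k z u))"
    and f: "f \<in> hcarrier H'" and g: "g \<in> hcarrier H"
  shows "hinner H (X f) g = hinner H' f (Y g)"
proof -
  have X_in: "X f \<in> hcarrier H" and Y_in: "Y g \<in> hcarrier H'"
    if "f \<in> hcarrier H'" "g \<in> hcarrier H" for f g
    using X Y that by (auto simp: linear_op_def)
  have X_add: "X (f + f') = X f + X f'" and X_scale: "X (a *\<^sub>C f) = a *\<^sub>C X f"
    if "f \<in> hcarrier H'" "f' \<in> hcarrier H'" for a f f'
    using X(1) that by (auto simp: linear_op_def)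
  have Y_add: "Y (g + g') = Y g + Y g'" and Y_scale: "Y (a *\<^sub>C g) = a *\<^sub>C Y g"
    if "g \<in> hcarrier H" "g' \<in> hcarrier H" for a g g'
    using Y(1) that by (auto simp: linear_op_def)
  have bound: "cmod (hinner H (X f) g - hinner H' f (Y g)) \<le> 2 * (hnorm H' f * hnorm H g)"
    if fg: "f \<in> hcarrier H'" "g \<in> hcarrier H" for f g
  proof -
    have "cmod (hinner H (X f) g) \<le> hnorm H (X f) * hnorm H g"
      by (rule F.cmod_hinner_le[OF X_in[OF fg] fg(2)])
    also have "\<dots> \<le> hnorm H' f * hnorm H g"
      using X(2)[OF fg(1)] F.hnorm_nonneg[OF fg(2)] by (rule mult_right_mono)
    finally have 1: "cmod (hinner H (X f) g) \<le> hnorm H' f * hnorm H g" .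
    have "cmod (hinner H' f (Y g)) \<le> hnorm H' f * hnorm H' (Y g)"
      by (rule F'.cmod_hinner_le[OF fg(1) Y_in[OF fg]])
    also have "\<dots> \<le> hnorm H' f * hnorm H g"
      using Y(2)[OF fg(2)] F'.hnorm_nonneg[OF fg(1)] by (rule mult_left_mono)
    finally show ?thesis
      using 1 norm_triangle_ineq4[of "hinner H (X f) g" "hinner H' f (Y g)"] by linarith
  qed
  have step: "hinner H (X f) (k z u) - hinner H' f (Y (k z u)) = 0"
    if z: "z \<in> \<Lambda>" and u: "u \<in> carrier_vec n" and f: "f \<in> hcarrier H'" for z u f
  proof (rule F'.bounded_functional_zero[OF F'.frame_set_sub F'.total,
        where \<phi> = "\<lambda>f. hinner H (X f) (k z u) - hinner H' f (Y (k z u))"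
          and C = "2 * hnorm H (k z u)"])
    have ku: "k z u \<in> hcarrier H" using z u by (rule F.k_in)
    fix f f'
    assume fH: "f \<in> hcarrier H'" and f'H: "f' \<in> hcarrier H'"
    show "hinner H (X (f + f')) (k z u) - hinner H' (f + f') (Y (k z u)) =
      (hinner H (X f) (k z u) - hinner H' f (Y (k z u))) +
      (hinner H (X f') (k z u) - hinner H' f' (Y (k z u)))"
      using fH f'H ku X_in Y_in by (simp add: X_add F.hinner_add_left F'.hinner_add_left)
  next
    have ku: "k z u \<in> hcarrier H" using z u by (rule F.k_in)
    fix f and a :: complex
    assume fH: "f \<in> hcarrier H'"
    show "hinner H (X (a *\<^sub>C f)) (k z u) - hinner H' (a *\<^sub>C f) (Y (k z u)) =
      a * (hinner H (X f) (k z u) - hinner H' f (Y (k z u)))"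
      using fH ku X_in Y_in
      by (simp add: X_scale F.hinner_scaleC_left F'.hinner_scaleC_left right_diff_distrib)
    show "cmod (hinner H (X f) (k z u) - hinner H' f (Y (k z u))) \<le> 2 * hnorm H (k z u) * hnorm H' f"
      using bound[OF fH ku] by (simp add: mult_ac)
  next
    fix f assume "f \<in> frame_set n' \<Lambda> k'"
    then show "hinner H (X f) (k z u) - hinner H' f (Y (k z u)) = 0"
      using frames z u by (auto simp: frame_set_def)
  qed (rule f)
  have "cnj (hinner H (X f) g - hinner H' f (Y g)) = 0"
  proof (rule F.bounded_functional_zero[OF F.frame_set_sub F.total,
        where \<phi> = "\<lambda>g. cnj (hinner H (X f) g - hinner H' f (Y g))" and C = "2 * hnorm H' f"])
    have Xf: "X f \<in> hcarrier H" using X_in[OF f g] .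
    fix g g' assume gH: "g \<in> hcarrier H" and g'H: "g' \<in> hcarrier H"
    show "cnj (hinner H (X f) (g + g') - hinner H' f (Y (g + g'))) =
      cnj (hinner H (X f) g - hinner H' f (Y g)) + cnj (hinner H (X f) g' - hinner H' f (Y g'))"
      using gH g'H f Xf Y_in[OF f] by (simp add: Y_add F.hinner_add_right F'.hinner_add_right)
  next
    have Xf: "X f \<in> hcarrier H" using X_in[OF f g] .
    fix g and a :: complex assume gH: "g \<in> hcarrier H"
    show "cnj (hinner H (X f) (a *\<^sub>C g) - hinner H' f (Y (a *\<^sub>C g))) =
      a * cnj (hinner H (X f) g - hinner H' f (Y g))"
      using gH f Xf Y_in[OF f]
      by (simp add: Y_scale F.hinner_scaleC_right F'.hinner_scaleC_right right_diff_distrib)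
    show "cmod (cnj (hinner H (X f) g - hinner H' f (Y g))) \<le> 2 * hnorm H' f * hnorm H g"
      unfolding complex_mod_cnj using bound[OF f gH] by (simp add: mult_ac)
  next
    fix g assume "g \<in> frame_set n \<Lambda> k"
    then show "cnj (hinner H (X f) g - hinner H' f (Y g)) = 0"
      using step f by (auto simp: frame_set_def)
  qed (rule g)
  then show ?thesis by simp
qed

text \<open>\<open>X\<close> maps the eigenvectors \<open>k' z v\<close> of \<open>T'\<close> to eigenvectors of \<open>T\<close> for the same eigenvalue;
  testing against the \<open>k' z v\<close> turns this into a statement about the adjoint \<open>Y\<close> of \<open>X\<close>.\<close>

lemma adjoint_intertwines:
  assumes X: "linear_op H' H X" and Y: "linear_op H H' Y"
    and XY: "\<And>f g. \<lbrakk>f \<in> hcarrier H'; g \<in> hcarrier H\<rbrakk> \<Longrightarrow> hinner H (X f) g = hinner H' f (Y g)"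
    and X_k: "\<And>z v. \<lbrakk>z \<in> \<Lambda>; v \<in> carrier_vec n'\<rbrakk> \<Longrightarrow> X (k' z v) = k z (A z *\<^sub>v v)"
    and A: "\<And>z. z \<in> \<Lambda> \<Longrightarrow> A z \<in> carrier_mat n n'"
    and g: "g \<in> hcarrier H"
  shows "Y (S g) = S' (Y g)"
proof (rule F'.eq_if_hinner_k)
  have Sg: "S g \<in> hcarrier H" using F.S_linear g by (auto simp: linear_op_def)
  have Yg: "Y g \<in> hcarrier H'" using Y g by (auto simp: linear_op_def)
  show "Y (S g) \<in> hcarrier H'" using Y Sg by (auto simp: linear_op_def)
  show "S' (Y g) \<in> hcarrier H'" using F'.S_linear Yg by (auto simp: linear_op_def)
  have YX: "hinner H' (Y h) f = hinner H h (X f)" if "f \<in> hcarrier H'" "h \<in> hcarrier H" for f h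
    using XY[OF that] that F'.hinner_cnj[of f "Y h"] F.hinner_cnj[of "X f" h] X Y
    by (auto simp: linear_op_def)
  fix z and v :: "complex Matrix.vec" assume z: "z \<in> \<Lambda>" and v: "v \<in> carrier_vec n'"
  have Av: "A z *\<^sub>v v \<in> carrier_vec n" using A[OF z] v by simp
  have "hinner H' (Y (S g)) (k' z v) = hinner H (S g) (k z (A z *\<^sub>v v))"
    using YX[OF F'.k_in[OF z v] Sg] X_k[OF z v] by simp
  also have "\<dots> = z * hinner H g (k z (A z *\<^sub>v v))"
    by (rule F.S_k[OF g z Av])
  also have "\<dots> = z * hinner H' (Y g) (k' z v)"
    using YX[OF F'.k_in[OF z v] g] X_k[OF z v] by simp
  also have "\<dots> = hinner H' (S' (Y g)) (k' z v)"
    by (rule F'.S_k[OF Yg z v, symmetric])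
  finally show "hinner H' (Y (S g)) (k' z v) = hinner H' (S' (Y g)) (k' z v)" .
qed

text \<open>The bounds give contractions \<open>X : H' \<rightarrow> H\<close> (multiplication by \<open>\<Theta>\<close>) and
  \<open>Y : H \<rightarrow> H'\<close> (multiplication by \<open>\<Gamma>\<close>), which by \<open>inter\<close> are adjoint to each other and intertwine the
  operators and their adjoints. Since \<open>Y X\<close> sends \<open>k' z v\<close> to \<open>k' z (\<Theta>(z)\<^sup>* \<Gamma>(z)\<^sup>* v)\<close>, an eigenvector of one
  matrix yields an eigenvector of \<open>Y X\<close>, and Schur's lemma makes \<open>Y X\<close> a scalar \<open>c\<close>; likewise \<open>X Y\<close>.
  If \<open>X = 0\<close> then \<open>Y = 0\<close>, and \<open>\<Theta>(z)\<^sup>* = 0\<close>. Otherwise both scalars agree, \<open>X\<close> is unitary up to a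
  factor, and comparing \<open>Y X\<close> and \<open>X Y\<close> on kernel vectors shows that \<open>\<Gamma>(z)\<close> inverts \<open>\<Theta>(z)\<close> up to \<open>c\<close>.\<close>

lemma multiplier_dichotomy:
  assumes \<Theta>: "\<And>z. z \<in> \<Lambda> \<Longrightarrow> \<Theta> z \<in> carrier_mat n n'"
    and \<Gamma>: "\<And>z. z \<in> \<Lambda> \<Longrightarrow> \<Gamma> z \<in> carrier_mat n' n"
    and inter: "\<And>z w. \<lbrakk>z \<in> \<Lambda>; w \<in> \<Lambda>\<rbrakk> \<Longrightarrow> K z w * mat_adjoint (\<Gamma> w) = \<Theta> z * K' z w"
    and contr: "\<And>L. set L \<subseteq> \<Lambda> \<times> carrier_vec n' \<Longrightarrow>
      hnorm H (\<Sum>(z, v)\<leftarrow>L. k z (mat_adjoint (\<Gamma> z) *\<^sub>v v)) \<le> hnorm H' (\<Sum>(z, v)\<leftarrow>L. k' z v)"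
    and contr': "\<And>L. set L \<subseteq> \<Lambda> \<times> carrier_vec n \<Longrightarrow>
      hnorm H' (\<Sum>(z, v)\<leftarrow>L. k' z (mat_adjoint (\<Theta> z) *\<^sub>v v)) \<le> hnorm H (\<Sum>(z, v)\<leftarrow>L. k z v)"
    and irr: "irreducible_op H T" and irr': "irreducible_op H' T'"
  shows "(\<forall>z\<in>\<Lambda>. \<Theta> z = 0\<^sub>m n n') \<or>
    (\<forall>z\<in>\<Lambda>. invertible_mat (\<Theta> z)) \<and> unitarily_equivalent H' T' H T"
proof -
  interpret R: frame_pair H' n' \<Lambda> T' S' K' k' H n T S K k ..
  have \<Theta>_adj: "mat_adjoint (\<Theta> z) \<in> carrier_mat n' n"
    and \<Gamma>_adj: "mat_adjoint (\<Gamma> z) \<in> carrier_mat n n'" if "z \<in> \<Lambda>" for z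
    using \<Theta> \<Gamma> that by auto
  obtain X where X: "linear_op H' H X" "\<And>f. f \<in> hcarrier H' \<Longrightarrow> hnorm H (X f) \<le> hnorm H' f"
    and X_k: "\<And>z v. \<lbrakk>z \<in> \<Lambda>; v \<in> carrier_vec n'\<rbrakk> \<Longrightarrow> X (k' z v) = k z (mat_adjoint (\<Gamma> z) *\<^sub>v v)"
    using frame_contraction[of "\<lambda>z. mat_adjoint (\<Gamma> z)", OF \<Gamma>_adj contr] by blast
  obtain Y where Y: "linear_op H H' Y" "\<And>g. g \<in> hcarrier H \<Longrightarrow> hnorm H' (Y g) \<le> hnorm H g"
    and Y_k: "\<And>z v. \<lbrakk>z \<in> \<Lambda>; v \<in> carrier_vec n\<rbrakk> \<Longrightarrow> Y (k z v) = k' z (mat_adjoint (\<Theta> z) *\<^sub>v v)"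
    using R.frame_contraction[of "\<lambda>z. mat_adjoint (\<Theta> z)", OF \<Theta>_adj contr'] by blast
  have X_in: "X f \<in> hcarrier H" and X_scale: "X (a *\<^sub>C f) = a *\<^sub>C X f"
    if "f \<in> hcarrier H'" for a f
    using X(1) that by (auto simp: linear_op_def)
  have Y_in: "Y g \<in> hcarrier H'" and Y_scale: "Y (a *\<^sub>C g) = a *\<^sub>C Y g"
    if "g \<in> hcarrier H" for a g
    using Y(1) that by (auto simp: linear_op_def)
  have T_in: "T g \<in> hcarrier H" "S g \<in> hcarrier H" if "g \<in> hcarrier H" for g
    using F.T_linear F.S_linear that by (auto simp: linear_op_def)
  have T'_in: "T' f \<in> hcarrier H'" "S' f \<in> hcarrier H'" if "f \<in> hcarrier H'" for f
    using F'.T_linear F'.S_linear that by (auto simp: linear_op_def)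
  have XY: "hinner H (X f) g = hinner H' f (Y g)" if "f \<in> hcarrier H'" "g \<in> hcarrier H" for f g
  proof (rule adjoint_if_adjoint_on_frames[OF X Y _ that])
    fix z w and u v :: "complex Matrix.vec"
    assume z: "z \<in> \<Lambda>" and w: "w \<in> \<Lambda>" and u: "u \<in> carrier_vec n" and v: "v \<in> carrier_vec n'"
    note [simp] = F.K_carrier[OF z w] F'.K_carrier[OF z w] \<Theta>[OF z] \<Gamma>[OF w]
      \<Theta>_adj[OF z] \<Gamma>_adj[OF w]
    have \<Gamma>v: "mat_adjoint (\<Gamma> w) *\<^sub>v v \<in> carrier_vec n" and \<Theta>u: "mat_adjoint (\<Theta> z) *\<^sub>v u \<in> carrier_vec n'"
      using mult_mat_vec_carrier[OF \<Gamma>_adj[OF w] v] mult_mat_vec_carrier[OF \<Theta>_adj[OF z] u] .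
    have "hinner H (X (k' w v)) (k z u) = (K z w *\<^sub>v (mat_adjoint (\<Gamma> w) *\<^sub>v v)) \<bullet>c u"
      unfolding X_k[OF w v] by (rule F.gram[OF z w \<Gamma>v u])
    also have "K z w *\<^sub>v (mat_adjoint (\<Gamma> w) *\<^sub>v v) = (K z w * mat_adjoint (\<Gamma> w)) *\<^sub>v v"
      by (rule assoc_mult_mat_vec[symmetric, OF F.K_carrier[OF z w] \<Gamma>_adj[OF w] v])
    also have "\<dots> = \<Theta> z *\<^sub>v (K' z w *\<^sub>v v)"
      unfolding inter[OF z w] by (rule assoc_mult_mat_vec[OF \<Theta>[OF z] F'.K_carrier[OF z w] v])
    also have "\<dots> \<bullet>c u = (K' z w *\<^sub>v v) \<bullet>c (mat_adjoint (\<Theta> z) *\<^sub>v u)"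
      by (rule cscalar_prod_mat_adjoint[OF \<Theta>[OF z] mult_mat_vec_carrier[OF F'.K_carrier[OF z w] v] u])
    also have "\<dots> = hinner H' (k' w v) (Y (k z u))"
      unfolding Y_k[OF z u] by (rule F'.gram[OF z w v \<Theta>u, symmetric])
    finally show "hinner H (X (k' w v)) (k z u) = hinner H' (k' w v) (Y (k z u))" .
  qed
  have YX: "hinner H' (Y g) f = hinner H g (X f)" if "f \<in> hcarrier H'" "g \<in> hcarrier H" for f g
    using XY[OF that] F'.hinner_cnj[OF that(1) Y_in[OF that(2)]] F.hinner_cnj[OF X_in[OF that(1)] that(2)]
    by simp
  have YS: "Y (S g) = S' (Y g)" if "g \<in> hcarrier H" for g
    by (rule adjoint_intertwines[OF X(1) Y(1) XY X_k \<Gamma>_adj that])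
  have XS: "X (S' f) = S (X f)" if "f \<in> hcarrier H'" for f
    by (rule R.adjoint_intertwines[OF Y(1) X(1) YX Y_k \<Theta>_adj that])
  have XT: "X (T' f) = T (X f)" if f: "f \<in> hcarrier H'" for f
  proof (rule F.eq_if_hinner_k[OF X_in[OF T'_in(1)[OF f]] T_in(1)[OF X_in[OF f]]])
    fix z and v :: "complex Matrix.vec" assume "z \<in> \<Lambda>" "v \<in> carrier_vec n"
    then have g: "k z v \<in> hcarrier H" by (rule F.k_in)
    let ?g = "k z v"
    have "hinner H ?g (X (T' f)) = hinner H' (S' (Y ?g)) f"
      using YX[OF T'_in(1)[OF f] g] F'.adj[OF Y_in[OF g] f] by simp
    also have "\<dots> = hinner H (S ?g) (X f)"
      using YS[OF g] YX[OF f T_in(2)[OF g]] by simp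
    also have "\<dots> = hinner H ?g (T (X f))"
      by (rule F.adj[OF g X_in[OF f]])
    finally show "hinner H (X (T' f)) ?g = hinner H (T (X f)) ?g"
      using F.hinner_cnj[OF g X_in[OF T'_in(1)[OF f]]] F.hinner_cnj[OF g T_in(1)[OF X_in[OF f]]]
      by simp
  qed
  have YT: "Y (T g) = T' (Y g)" if g: "g \<in> hcarrier H" for g
  proof (rule F'.eq_if_hinner_k[OF Y_in[OF T_in(1)[OF g]] T'_in(1)[OF Y_in[OF g]]])
    fix z and v :: "complex Matrix.vec" assume "z \<in> \<Lambda>" "v \<in> carrier_vec n'"
    then have f: "k' z v \<in> hcarrier H'" by (rule F'.k_in)
    let ?f = "k' z v"
    have "hinner H' ?f (Y (T g)) = hinner H (S (X ?f)) g"
      using XY[OF f T_in(1)[OF g]] F.adj[OF X_in[OF f] g] by simp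
    also have "\<dots> = hinner H' (S' ?f) (Y g)"
      using XS[OF f] XY[OF T'_in(2)[OF f] g] by simp
    also have "\<dots> = hinner H' ?f (T' (Y g))"
      by (rule F'.adj[OF f Y_in[OF g]])
    finally show "hinner H' (Y (T g)) ?f = hinner H' (T' (Y g)) ?f"
      using F'.hinner_cnj[OF f Y_in[OF T_in(1)[OF g]]] F'.hinner_cnj[OF f T'_in(1)[OF Y_in[OF g]]]
      by simp
  qed
  obtain z0 where z0: "z0 \<in> \<Lambda>" using F.\<Lambda>_nonempty by blast
  have scalar': "\<exists>c. \<forall>f\<in>hcarrier H'. Y (X f) = c *\<^sub>C f"
  proof -
    obtain v c where v: "v \<in> carrier_vec n'" "v \<noteq> 0\<^sub>v n'"
      and eig: "(mat_adjoint (\<Theta> z0) * mat_adjoint (\<Gamma> z0)) *\<^sub>v v = c \<cdot>\<^sub>v v"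
      using eigenvector_ex[OF mult_carrier_mat[OF \<Theta>_adj[OF z0] \<Gamma>_adj[OF z0]] F'.n_pos] by blast
    have "Y (X (k' z0 v)) = k' z0 (mat_adjoint (\<Theta> z0) *\<^sub>v (mat_adjoint (\<Gamma> z0) *\<^sub>v v))"
      unfolding X_k[OF z0 v(1)] by (rule Y_k[OF z0 mult_mat_vec_carrier[OF \<Gamma>_adj[OF z0] v(1)]])
    also have "\<dots> = c *\<^sub>C k' z0 v"
      unfolding assoc_mult_mat_vec[symmetric, OF \<Theta>_adj[OF z0] \<Gamma>_adj[OF z0] v(1)] eig
      by (rule F'.k_scale[OF z0 v(1)])
    finally have ev: "Y (X (k' z0 v)) = c *\<^sub>C k' z0 v" .
    have lin: "linear_op H' H' (\<lambda>f. Y (X f))"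
      using X(1) Y(1) unfolding linear_op_def by simp
    have "Y (X f) = c *\<^sub>C f" if "f \<in> hcarrier H'" for f
      by (rule F'.irreducible_commutant_scalar[where A = "\<lambda>f. Y (X f)", OF irr' F'.T_linear F'.S_linear F'.adj lin _ _ _
            F'.k_in[OF z0 v(1)] F'.k_nonzero[OF z0 v] ev that])
        (simp_all add: XY[symmetric] YX X_in Y_in XT YT XS YS)
    then show ?thesis by blast
  qed
  have scalar: "\<exists>c. \<forall>g\<in>hcarrier H. X (Y g) = c *\<^sub>C g"
  proof -
    obtain v c where v: "v \<in> carrier_vec n" "v \<noteq> 0\<^sub>v n"
      and eig: "(mat_adjoint (\<Gamma> z0) * mat_adjoint (\<Theta> z0)) *\<^sub>v v = c \<cdot>\<^sub>v v"
      using eigenvector_ex[OF mult_carrier_mat[OF \<Gamma>_adj[OF z0] \<Theta>_adj[OF z0]] F.n_pos] by blast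
    have "X (Y (k z0 v)) = k z0 (mat_adjoint (\<Gamma> z0) *\<^sub>v (mat_adjoint (\<Theta> z0) *\<^sub>v v))"
      unfolding Y_k[OF z0 v(1)] by (rule X_k[OF z0 mult_mat_vec_carrier[OF \<Theta>_adj[OF z0] v(1)]])
    also have "\<dots> = c *\<^sub>C k z0 v"
      unfolding assoc_mult_mat_vec[symmetric, OF \<Gamma>_adj[OF z0] \<Theta>_adj[OF z0] v(1)] eig
      by (rule F.k_scale[OF z0 v(1)])
    finally have ev: "X (Y (k z0 v)) = c *\<^sub>C k z0 v" .
    have lin: "linear_op H H (\<lambda>f. X (Y f))"
      using X(1) Y(1) unfolding linear_op_def by simp
    have "X (Y f) = c *\<^sub>C f" if "f \<in> hcarrier H" for f
      by (rule F.irreducible_commutant_scalar[where A = "\<lambda>f. X (Y f)", OF irr F.T_linear F.S_linear F.adj lin _ _ _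
            F.k_in[OF z0 v(1)] F.k_nonzero[OF z0 v] ev that])
        (simp_all add: YX[symmetric] XY X_in Y_in XT YT XS YS)
    then show ?thesis by blast
  qed
  obtain c where c: "\<And>f. f \<in> hcarrier H' \<Longrightarrow> Y (X f) = c *\<^sub>C f" using scalar' by blast
  obtain c' where c': "\<And>g. g \<in> hcarrier H \<Longrightarrow> X (Y g) = c' *\<^sub>C g" using scalar by blast
  have XX: "hinner H (X f) (X g) = cnj c * hinner H' f g" if "f \<in> hcarrier H'" "g \<in> hcarrier H'" for f g
    using XY[OF that(1) X_in[OF that(2)]] c[OF that(2)] that by (simp add: F'.hinner_scaleC_right)
  show ?thesis
  proof (cases "\<forall>f\<in>hcarrier H'. X f = 0")
    case True
    have "\<Theta> z = 0\<^sub>m n n'" if z: "z \<in> \<Lambda>" for z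
    proof -
      have zero: "mat_adjoint (\<Theta> z) *\<^sub>v u = 0\<^sub>v n'" if u: "u \<in> carrier_vec n" for u :: "complex Matrix.vec"
      proof -
        have "hinner H' (Y (k z u)) f = 0" if "f \<in> hcarrier H'" for f
          using YX[OF that F.k_in[OF z u]] True that F.hinner_zero_right[OF F.k_in[OF z u]] by simp
        then have "Y (k z u) \<in> horth H' (hcarrier H')"
          using Y_in[OF F.k_in[OF z u]] by (simp add: horth_def)
        then have "k' z (mat_adjoint (\<Theta> z) *\<^sub>v u) = 0"
          by (simp add: F'.horth_whole Y_k[OF z u])
        then show ?thesis
          using F'.k_nonzero[OF z mult_mat_vec_carrier[OF \<Theta>_adj[OF z] u]] by blast
      qed
      have "cnj (\<Theta> z $$ (i, j)) = 0" if ij: "i < n" "j < n'" for i j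
      proof -
        have "cnj (\<Theta> z $$ (i, j)) = vec_index (mat_adjoint (\<Theta> z) *\<^sub>v unit_vec n i) j"
          using \<Theta>[OF z] ij by (auto simp: scalar_prod_right_unit)
        then show ?thesis using zero[of "unit_vec n i"] ij by simp
      qed
      then show ?thesis using \<Theta>[OF z] by (intro eq_matI) auto
    qed
    then show ?thesis by blast
  next
    case False
    then obtain f0 where f0: "f0 \<in> hcarrier H'" "X f0 \<noteq> 0" by blast
    then have f0_nz: "f0 \<noteq> 0"
      using X_scale[OF f0(1), of 0] by auto
    have "c *\<^sub>C X f0 = c' *\<^sub>C X f0"
      using c[OF f0(1)] c'[OF X_in[OF f0(1)]] X_scale[OF f0(1)] by simp
    then have cc': "c' = c" using f0(2) by simp
    \<comment> \<open>\<open>c\<close> is the square of the norm of \<open>X\<close>, hence a positive real\<close>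
    define r where "r = (hnorm H (X f0) / hnorm H' f0)\<^sup>2"
    have nz: "hnorm H (X f0) \<noteq> 0" "hnorm H' f0 \<noteq> 0"
      using f0 f0_nz X_in by (auto simp: F.hnorm_eq_0 F'.hnorm_eq_0)
    then have r: "0 < r" by (simp add: r_def)
    have "cnj c * complex_of_real ((hnorm H' f0)\<^sup>2) = complex_of_real ((hnorm H (X f0))\<^sup>2)"
      using XX[OF f0(1) f0(1)] F.hinner_self[OF X_in[OF f0(1)]] F'.hinner_self[OF f0(1)] by simp
    then have "cnj c = complex_of_real r"
      using nz by (simp add: r_def field_simps power_divide)
    then have c_r: "c = complex_of_real r"
      by (metis complex_cnj_cnj complex_cnj_complex_of_real)
    define a where "a = complex_of_real (1 / sqrt r)"
    have aac: "a * a * c = 1" and cnj_a: "cnj a = a"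
      using r by (simp_all add: a_def c_r field_simps flip: of_real_mult)
    define U where "U f = a *\<^sub>C X f" for f
    define V where "V g = a *\<^sub>C Y g" for g
    have UV: "U (V g) = g" if "g \<in> hcarrier H" for g
      using that aac by (simp add: U_def V_def X_scale Y_in c' cc' mult_ac)
    have VU: "V (U f) = f" if "f \<in> hcarrier H'" for f
      using that aac by (simp add: U_def V_def Y_scale X_in c mult_ac)
    have "unitarily_equivalent H' T' H T"
      unfolding unitarily_equivalent_def
    proof (intro exI[of _ U] conjI ballI)
      show "linear_op H' H U"
        using X(1) unfolding linear_op_def U_def
        by (simp add: F.hcarrier_closed complex_vector.scale_right_distrib mult.commute)
      show "bij_betw U (hcarrier H') (hcarrier H)"
        by (rule bij_betw_byWitness[where f' = V])
          (auto simp: UV VU, auto simp: U_def V_def X_in Y_in F.hcarrier_closed F'.hcarrier_closed)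
    next
      fix f g assume fg: "f \<in> hcarrier H'" "g \<in> hcarrier H'"
      have "hinner H (U f) (U g) = a * a * c * hinner H' f g"
        using fg X_in XX[OF fg] cnj_a
        by (simp add: U_def F.hinner_scaleC_left F.hinner_scaleC_right F.hcarrier_closed c_r)
      then show "hinner H (U f) (U g) = hinner H' f g" by (simp add: aac)
    next
      fix f assume f: "f \<in> hcarrier H'"
      show "U (T' f) = T (U f)"
        using F.T_linear X_in[OF f] by (simp add: U_def XT[OF f] linear_op_def)
    qed
    moreover have "invertible_mat (\<Theta> z)" if z: "z \<in> \<Lambda>" for z
    proof (rule invertible_mat_if_scalar_products[OF \<Theta>[OF z] \<Gamma>[OF z]])
      show "c \<noteq> 0" using aac by auto
      have c_real: "cnj c = c" by (simp add: c_r)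
      have adj_smult: "mat_adjoint (c \<cdot>\<^sub>m 1\<^sub>m i) = c \<cdot>\<^sub>m 1\<^sub>m i" for i
        by (rule eq_matI) (auto simp: c_real)
      have "mat_adjoint (\<Gamma> z) * mat_adjoint (\<Theta> z) = c \<cdot>\<^sub>m 1\<^sub>m n"
      proof (rule mat_eq_scalar_one_if_mult_vec[OF mult_carrier_mat[OF \<Gamma>_adj[OF z] \<Theta>_adj[OF z]]])
        fix v :: "complex Matrix.vec" assume v: "v \<in> carrier_vec n"
        have \<Theta>v: "mat_adjoint (\<Theta> z) *\<^sub>v v \<in> carrier_vec n'"
          by (rule mult_mat_vec_carrier[OF \<Theta>_adj[OF z] v])
        have "k z (mat_adjoint (\<Gamma> z) *\<^sub>v (mat_adjoint (\<Theta> z) *\<^sub>v v)) = X (Y (k z v))"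
          unfolding Y_k[OF z v] X_k[OF z \<Theta>v] ..
        also have "\<dots> = k z (c \<cdot>\<^sub>v v)"
          unfolding c'[OF F.k_in[OF z v]] cc' F.k_scale[OF z v] ..
        finally show "(mat_adjoint (\<Gamma> z) * mat_adjoint (\<Theta> z)) *\<^sub>v v = c \<cdot>\<^sub>v v"
          unfolding assoc_mult_mat_vec[OF \<Gamma>_adj[OF z] \<Theta>_adj[OF z] v]
          by (intro F.k_inj[OF z]) (auto intro: mult_mat_vec_carrier[OF \<Gamma>_adj[OF z] \<Theta>v] v)
      qed
      then show "\<Theta> z * \<Gamma> z = c \<cdot>\<^sub>m 1\<^sub>m n"
        using mat_adjoint_mult[OF \<Theta>[OF z] \<Gamma>[OF z]] adj_smult mat_adjoint_involutive by metis
      have "mat_adjoint (\<Theta> z) * mat_adjoint (\<Gamma> z) = c \<cdot>\<^sub>m 1\<^sub>m n'"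
      proof (rule mat_eq_scalar_one_if_mult_vec[OF mult_carrier_mat[OF \<Theta>_adj[OF z] \<Gamma>_adj[OF z]]])
        fix v :: "complex Matrix.vec" assume v: "v \<in> carrier_vec n'"
        have \<Gamma>v: "mat_adjoint (\<Gamma> z) *\<^sub>v v \<in> carrier_vec n"
          by (rule mult_mat_vec_carrier[OF \<Gamma>_adj[OF z] v])
        have "k' z (mat_adjoint (\<Theta> z) *\<^sub>v (mat_adjoint (\<Gamma> z) *\<^sub>v v)) = Y (X (k' z v))"
          unfolding X_k[OF z v] Y_k[OF z \<Gamma>v] ..
        also have "\<dots> = k' z (c \<cdot>\<^sub>v v)"
          unfolding c[OF F'.k_in[OF z v]] F'.k_scale[OF z v] ..
        finally show "(mat_adjoint (\<Theta> z) * mat_adjoint (\<Gamma> z)) *\<^sub>v v = c \<cdot>\<^sub>v v"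
          unfolding assoc_mult_mat_vec[OF \<Theta>_adj[OF z] \<Gamma>_adj[OF z] v]
          by (intro F'.k_inj[OF z]) (auto intro: mult_mat_vec_carrier[OF \<Theta>_adj[OF z] \<Gamma>v] v)
      qed
      then show "\<Gamma> z * \<Theta> z = c \<cdot>\<^sub>m 1\<^sub>m n'"
        using mat_adjoint_mult[OF \<Gamma>[OF z] \<Theta>[OF z]] adj_smult mat_adjoint_involutive by metis
    qed
    ultimately show ?thesis by blast
  qed
qed

end

section \<open>Block matrices\<close>

lemma sum_lessThan_add:
  fixes f :: "nat \<Rightarrow> 'a::comm_monoid_add"
  shows "(\<Sum>i<a + b. f i) = (\<Sum>i<a. f i) + (\<Sum>i<b. f (a + i))"
  by (induction b) (simp_all add: add.assoc)

text \<open>Positions in a blocked matrix are written as the offset of a block plus a position inside it;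
  the block identities below all come from the corresponding splitting of sums.\<close>

lemma sum_over_blocks:
  fixes f :: "nat \<Rightarrow> 'a::comm_monoid_add"
  shows "(\<Sum>i<sum_list rs. f i) = (\<Sum>p<length rs. \<Sum>a<rs ! p. f (sum_list (take p rs) + a))"
proof (induction rs arbitrary: f)
  case (Cons r rs)
  show ?case
    by (simp add: sum_lessThan_add Cons.IH sum.lessThan_Suc_shift add.assoc del: sum.lessThan_Suc)
qed simp

lemma block_index_less:
  "\<lbrakk>p < length rs; a < rs ! p\<rbrakk> \<Longrightarrow> sum_list (take p rs) + a < sum_list (rs :: nat list)"
proof (induction rs arbitrary: p)
  case (Cons r rs)
  then show ?case by (cases p) (auto simp: add.assoc)
qed simp

lemma block_index_cases:
  assumes "i < sum_list (rs :: nat list)"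
  obtains p a where "p < length rs" "a < rs ! p" "i = sum_list (take p rs) + a"
proof -
  have "\<exists>p a. p < length rs \<and> a < rs ! p \<and> i = sum_list (take p rs) + a"
    using assms
  proof (induction rs arbitrary: i)
    case (Cons r rs)
    show ?case
    proof (cases "i < r")
      case True
      then show ?thesis by (intro exI[of _ 0] exI[of _ i]) simp
    next
      case False
      then have "i - r < sum_list rs" using Cons.prems by simp
      then obtain p a where "p < length rs" "a < rs ! p" "i - r = sum_list (take p rs) + a"
        using Cons.IH by blast
      then show ?thesis using False by (intro exI[of _ "Suc p"] exI[of _ a]) simp
    qed
  qed simp
  then show ?thesis using that by blast
qed

lemma mat_block_carrier [simp]:
  "mat_block rs cs A p q \<in> carrier_mat (rs ! p) (cs ! q)"
  by (simp add: mat_block_def)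

lemma dim_mat_block [simp]:
  "dim_row (mat_block rs cs A p q) = rs ! p" "dim_col (mat_block rs cs A p q) = cs ! q"
  by (simp_all add: mat_block_def)

lemma index_mat_block [simp]:
  "\<lbrakk>a < rs ! p; b < cs ! q\<rbrakk> \<Longrightarrow> mat_block rs cs A p q $$ (a, b) =
    A $$ (sum_list (take p rs) + a, sum_list (take q cs) + b)"
  by (simp add: mat_block_def)

lemma index_diag_block_mat:
  assumes "\<And>D. D \<in> set Ds \<Longrightarrow> dim_col D = dim_row D"
    and "p < length Ds" "q < length Ds" "a < dim_row (Ds ! p)" "b < dim_row (Ds ! q)"
  shows "diag_block_mat Ds $$ (sum_list (take p (map dim_row Ds)) + a, sum_list (take q (map dim_row Ds)) + b)
    = (if p = q then Ds ! p $$ (a, b) else 0)"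
  using assms
proof (induction Ds arbitrary: p q)
  case (Cons D Ds)
  let ?rs = "map dim_row Ds"
  have sq: "dim_col D = dim_row D" "\<And>D. D \<in> set Ds \<Longrightarrow> dim_col D = dim_row D"
    using Cons.prems(1) by auto
  have cols: "map dim_col Ds = map dim_row Ds" using sq(2) by simp
  have less: "sum_list (take i ?rs) + c < sum_list ?rs" if "i < length Ds" "c < dim_row (Ds ! i)" for i c
    using block_index_less[of i ?rs c] that by simp
  show ?case
  proof (cases p)
    case 0
    show ?thesis
    proof (cases q)
      case 0
      then show ?thesis using \<open>p = 0\<close> Cons.prems sq by (simp add: Let_def)
    next
      case (Suc q')
      then show ?thesis
        using \<open>p = 0\<close> Cons.prems sq less[of q' b] by (simp add: Let_def dim_diag_block_mat cols add.assoc)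
    qed
  next
    case (Suc p')
    show ?thesis
    proof (cases q)
      case 0
      then show ?thesis
        using \<open>p = Suc p'\<close> Cons.prems sq less[of p' a] by (simp add: Let_def dim_diag_block_mat cols add.assoc)
    next
      case (Suc q')
      then show ?thesis
        using \<open>p = Suc p'\<close> Cons.prems sq less[of p' a] less[of q' b] Cons.IH[OF sq(2), of p' q']
        by (simp add: Let_def dim_diag_block_mat cols add.assoc)
    qed
  qed
qed simp

lemma diag_block_mat_carrier:
  assumes "\<And>D. D \<in> set Ds \<Longrightarrow> dim_col D = dim_row D"
  shows "diag_block_mat Ds \<in> carrier_mat (sum_list (map dim_row Ds)) (sum_list (map dim_row Ds))"
  using assms by (intro carrier_matI) (simp_all add: dim_diag_block_mat cong: map_cong)

lemma mat_block_mult_diag_block_mat: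
  fixes A :: "complex mat"
  assumes sq: "\<And>D. D \<in> set Ds \<Longrightarrow> dim_col D = dim_row D" and cs: "cs = map dim_row Ds"
    and A: "A \<in> carrier_mat (sum_list rs) (sum_list cs)"
    and p: "p < length rs" and q: "q < length Ds"
  shows "mat_block rs cs (A * diag_block_mat Ds) p q = mat_block rs cs A p q * Ds ! q"
proof (rule eq_matI)
  have Dq: "dim_col (Ds ! q) = dim_row (Ds ! q)" "dim_row (Ds ! q) = cs ! q"
    using sq q cs by simp_all
  have D: "diag_block_mat Ds \<in> carrier_mat (sum_list cs) (sum_list cs)"
    unfolding cs using sq by (rule diag_block_mat_carrier)
  fix a b assume "a < dim_row (mat_block rs cs A p q * Ds ! q)" "b < dim_col (mat_block rs cs A p q * Ds ! q)"
  then have a: "a < rs ! p" and b: "b < cs ! q" using Dq by simp_all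
  let ?i = "sum_list (take p rs) + a" and ?j = "sum_list (take q cs) + b"
  have i: "?i < sum_list rs" using p a by (rule block_index_less)
  have j: "?j < sum_list cs" using q b cs by (intro block_index_less) simp_all
  have "(A * diag_block_mat Ds) $$ (?i, ?j) = (\<Sum>x<sum_list cs. A $$ (?i, x) * diag_block_mat Ds $$ (x, ?j))"
    using A D i j by (simp add: scalar_prod_def atLeast0LessThan)
  also have "\<dots> = (\<Sum>s<length cs. \<Sum>c<cs ! s. A $$ (?i, sum_list (take s cs) + c) *
      (if s = q then Ds ! q $$ (c, b) else 0))"
    unfolding sum_over_blocks using sq b q cs
    by (intro sum.cong refl) (simp add: index_diag_block_mat)
  also have "\<dots> = (\<Sum>s<length cs. if s = q then \<Sum>c<cs ! q. A $$ (?i, sum_list (take q cs) + c) * Ds ! q $$ (c, b) else 0)"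
    by (intro sum.cong) auto
  also have "\<dots> = (\<Sum>c<cs ! q. A $$ (?i, sum_list (take q cs) + c) * Ds ! q $$ (c, b))"
    using q cs by simp
  also have "\<dots> = (mat_block rs cs A p q * Ds ! q) $$ (a, b)"
    using a b Dq by (simp add: scalar_prod_def atLeast0LessThan)
  finally show "mat_block rs cs (A * diag_block_mat Ds) p q $$ (a, b) = (mat_block rs cs A p q * Ds ! q) $$ (a, b)"
    using a b by simp
qed (use sq q cs in auto)

lemma mat_block_mat_adjoint:
  fixes A :: "complex mat"
  assumes "A \<in> carrier_mat (sum_list cs) (sum_list rs)" "p < length rs" "q < length cs"
  shows "mat_block rs cs (mat_adjoint A) p q = mat_adjoint (mat_block cs rs A q p)"
  using assms by (intro eq_matI) (simp_all add: block_index_less)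

lemma mat_adjoint_diag_block_mat:
  fixes Ds :: "complex mat list"
  shows "mat_adjoint (diag_block_mat Ds) = diag_block_mat (map mat_adjoint Ds)"
proof (induction Ds)
  case (Cons D Ds)
  then show ?case by (simp add: Let_def flip: Cons.IH) (rule eq_matI; auto)
qed (auto intro!: eq_matI)

text \<open>Taking adjoints reduces this to the product with a block diagonal matrix on the right.\<close>

lemma diag_block_mat_mult_mat_block:
  fixes A :: "complex mat"
  assumes sq: "\<And>D. D \<in> set Ds \<Longrightarrow> dim_col D = dim_row D" and rs: "rs = map dim_row Ds"
    and A: "A \<in> carrier_mat (sum_list rs) (sum_list cs)"
    and p: "p < length Ds" and q: "q < length cs"
  shows "mat_block rs cs (diag_block_mat Ds * A) p q = Ds ! p * mat_block rs cs A p q"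
proof -
  have D: "diag_block_mat Ds \<in> carrier_mat (sum_list rs) (sum_list rs)"
    unfolding rs using sq by (rule diag_block_mat_carrier)
  have Dp: "Ds ! p \<in> carrier_mat (rs ! p) (rs ! p)"
    using sq p rs by (intro carrier_matI) simp_all
  have rs': "rs = map dim_row (map mat_adjoint Ds)"
    using sq rs by (simp add: comp_def)
  have "mat_block rs cs (diag_block_mat Ds * A) p q
      = mat_adjoint (mat_block cs rs (mat_adjoint (diag_block_mat Ds * A)) q p)"
    using mat_block_mat_adjoint[of "mat_adjoint (diag_block_mat Ds * A)" cs rs p q] A D p q rs by simp
  also have "mat_adjoint (diag_block_mat Ds * A) = mat_adjoint A * diag_block_mat (map mat_adjoint Ds)"
    unfolding mat_adjoint_mult[OF D A] mat_adjoint_diag_block_mat ..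
  also have "mat_block cs rs \<dots> q p = mat_block cs rs (mat_adjoint A) q p * map mat_adjoint Ds ! p"
  proof (rule mat_block_mult_diag_block_mat[OF _ rs'])
    fix D assume "D \<in> set (map mat_adjoint Ds)"
    then show "dim_col D = dim_row D" using sq by auto
  qed (use A p q in simp_all)
  also have "map mat_adjoint Ds ! p = mat_adjoint (Ds ! p)" using p by simp
  also have "mat_block cs rs (mat_adjoint A) q p = mat_adjoint (mat_block rs cs A p q)"
    using A p q rs by (intro mat_block_mat_adjoint) simp_all
  also have "mat_adjoint (mat_adjoint (mat_block rs cs A p q) * mat_adjoint (Ds ! p)) = Ds ! p * mat_block rs cs A p q"
    using mat_adjoint_mult[OF Dp mat_block_carrier[of rs cs A p q]] by (metis mat_adjoint_involutive)
  finally show ?thesis .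
qed

text \<open>The diagonal blocks of \<open>A B = 1\<close>, in the scalar form in which norms of kernel sums are
  compared later.\<close>

lemma sum_mat_block_inverse:
  fixes A B :: "complex mat"
  assumes A: "A \<in> carrier_mat (sum_list cs) (sum_list rs)" and B: "B \<in> carrier_mat (sum_list rs) (sum_list cs)"
    and AB: "A * B = 1\<^sub>m (sum_list cs)" and q: "q < length cs"
    and v: "v \<in> carrier_vec (cs ! q)" and w: "w \<in> carrier_vec (cs ! q)"
  shows "(\<Sum>p<length rs. ((mat_block cs rs A q p * mat_block rs cs B p q) *\<^sub>v v) \<bullet>c w) = v \<bullet>c w"
proof -
  let ?P = "\<lambda>p. mat_block cs rs A q p * mat_block rs cs B p q"
  let ?o = "sum_list (take q cs)"
  have P: "?P p \<in> carrier_mat (cs ! q) (cs ! q)" for p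
    by (rule mult_carrier_mat[OF mat_block_carrier mat_block_carrier])
  have entry: "(\<Sum>p<length rs. ?P p $$ (i, j)) = (if i = j then 1 else 0)"
    if ij: "i < cs ! q" "j < cs ! q" for i j
  proof -
    have lt: "?o + i < sum_list cs" "?o + j < sum_list cs"
      using q ij by (auto intro: block_index_less)
    have "(\<Sum>p<length rs. ?P p $$ (i, j)) =
      (\<Sum>p<length rs. \<Sum>c<rs ! p. A $$ (?o + i, sum_list (take p rs) + c) * B $$ (sum_list (take p rs) + c, ?o + j))"
      using ij by (intro sum.cong refl) (simp add: scalar_prod_def atLeast0LessThan)
    also have "\<dots> = (\<Sum>x<sum_list rs. A $$ (?o + i, x) * B $$ (x, ?o + j))"
      by (rule sum_over_blocks[symmetric])
    also have "\<dots> = (A * B) $$ (?o + i, ?o + j)"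
      using A B lt by (simp add: scalar_prod_def atLeast0LessThan)
    finally show ?thesis using lt by (simp add: AB)
  qed
  have "(\<Sum>p<length rs. (?P p *\<^sub>v v) \<bullet>c w) =
      (\<Sum>p<length rs. \<Sum>i<cs ! q. \<Sum>j<cs ! q. ?P p $$ (i, j) * vec_index v j * cnj (vec_index w i))"
    by (intro sum.cong refl cscalar_prod_mult_mat_vec[OF P v w])
  also have "\<dots> = (\<Sum>i<cs ! q. \<Sum>p<length rs. \<Sum>j<cs ! q. ?P p $$ (i, j) * vec_index v j * cnj (vec_index w i))"
    by (rule sum.swap)
  also have "\<dots> = (\<Sum>i<cs ! q. \<Sum>j<cs ! q. \<Sum>p<length rs. ?P p $$ (i, j) * vec_index v j * cnj (vec_index w i))"
    by (intro sum.cong refl sum.swap)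
  also have "\<dots> = (\<Sum>i<cs ! q. \<Sum>j<cs ! q. (if i = j then 1 else 0) * vec_index v j * cnj (vec_index w i))"
    by (intro sum.cong refl) (simp only: lessThan_iff entry flip: sum_distrib_right)
  also have "\<dots> = (\<Sum>i<cs ! q. \<Sum>j<cs ! q. if j = i then vec_index v i * cnj (vec_index w i) else 0)"
    by (intro sum.cong refl) auto
  also have "\<dots> = v \<bullet>c w"
    using v w by (simp add: scalar_prod_def atLeast0LessThan)
  finally show ?thesis .
qed

section \<open>Columns of multipliers\<close>

lemma (in inner_product_space) sum_list_closed:
  "(\<And>x. x \<in> set L \<Longrightarrow> f x \<in> hcarrier H) \<Longrightarrow> (\<Sum>x\<leftarrow>L. f x) \<in> hcarrier H"
  by (induction L) (auto simp: hcarrier_closed)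

lemma (in inner_product_space) hinner_sum_list:
  assumes "\<And>x. x \<in> set L \<Longrightarrow> f x \<in> hcarrier H" "\<And>y. y \<in> set M \<Longrightarrow> g y \<in> hcarrier H"
  shows "hinner H (\<Sum>x\<leftarrow>L. f x) (\<Sum>y\<leftarrow>M. g y) = (\<Sum>x\<leftarrow>L. \<Sum>y\<leftarrow>M. hinner H (f x) (g y))"
proof -
  have M_in: "(\<Sum>y\<leftarrow>M. g y) \<in> hcarrier H"
    using assms(2) by (rule sum_list_closed)
  have right: "hinner H h (\<Sum>y\<leftarrow>M. g y) = (\<Sum>y\<leftarrow>M. hinner H h (g y))" if h: "h \<in> hcarrier H" for h
    using assms(2)
  proof (induction M)
    case (Cons y M)
    have "(\<Sum>y\<leftarrow>M. g y) \<in> hcarrier H"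
      using Cons.prems by (intro sum_list_closed) auto
    then show ?case using Cons h by (simp add: hinner_add_right)
  qed (simp add: h hinner_zero_right)
  show ?thesis
    using assms(1)
  proof (induction L)
    case (Cons x L)
    have "(\<Sum>x\<leftarrow>L. f x) \<in> hcarrier H"
      using Cons.prems by (intro sum_list_closed) auto
    then show ?case using Cons M_in by (simp add: hinner_add_left right)
  qed (simp add: M_in hinner_zero_left)
qed

lemma sum_sum_list_swap:
  fixes f :: "'p \<Rightarrow> 'x \<Rightarrow> 'a::comm_monoid_add"
  shows "(\<Sum>p\<in>A. \<Sum>x\<leftarrow>L. f p x) = (\<Sum>x\<leftarrow>L. \<Sum>p\<in>A. f p x)"
  by (induction L) (simp_all add: sum.distrib)

text \<open>Why a single block multiplier is contractive: the column of all \<open>\<Theta> p\<close> is isometric on finite sums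
  of kernel vectors. Indeed the Gram matrix of the images, summed over \<open>p\<close>, is
  \<open>\<Sum>p. \<Gamma> p z * K p z w * (\<Gamma> p w)\<^sup>* = \<Sum>p. \<Gamma> p z * \<Theta> p z * K' z w = K' z w\<close>, so the squared norms of
  the images add up to the squared norm of the argument.\<close>

lemma multiplier_column_contraction:
  fixes Hs :: "nat \<Rightarrow> 'a::complex_vector ip_space" and H' :: "'b::complex_vector ip_space"
  assumes F: "\<And>p. p < N \<Longrightarrow> kernel_frame (Hs p) (ns p) \<Lambda> (Ts p) (Ss p) (Ks p) (ks p)"
    and F': "kernel_frame H' n' \<Lambda> T' S' K' k'"
    and \<Theta>: "\<And>p z. \<lbrakk>p < N; z \<in> \<Lambda>\<rbrakk> \<Longrightarrow> \<Theta> p z \<in> carrier_mat (ns p) n'"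
    and \<Gamma>: "\<And>p z. \<lbrakk>p < N; z \<in> \<Lambda>\<rbrakk> \<Longrightarrow> \<Gamma> p z \<in> carrier_mat n' (ns p)"
    and inter: "\<And>p z w. \<lbrakk>p < N; z \<in> \<Lambda>; w \<in> \<Lambda>\<rbrakk> \<Longrightarrow> Ks p z w * mat_adjoint (\<Gamma> p w) = \<Theta> p z * K' z w"
    and id: "\<And>z u v. \<lbrakk>z \<in> \<Lambda>; u \<in> carrier_vec n'; v \<in> carrier_vec n'\<rbrakk>
      \<Longrightarrow> (\<Sum>p<N. ((\<Gamma> p z * \<Theta> p z) *\<^sub>v v) \<bullet>c u) = v \<bullet>c u"
    and L: "set L \<subseteq> \<Lambda> \<times> carrier_vec n'" and p: "p < N"
  shows "hnorm (Hs p) (\<Sum>(z, v)\<leftarrow>L. ks p z (mat_adjoint (\<Gamma> p z) *\<^sub>v v)) \<le> hnorm H' (\<Sum>(z, v)\<leftarrow>L. k' z v)"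
proof -
  interpret F': kernel_frame H' n' \<Lambda> T' S' K' k' by fact
  let ?f = "\<lambda>p (z, v). ks p z (mat_adjoint (\<Gamma> p z) *\<^sub>v v)" and ?f' = "\<lambda>(z, v). k' z v"
  have mem: "fst x \<in> \<Lambda>" "snd x \<in> carrier_vec n'" if "x \<in> set L" for x
    using L that by auto
  have \<Gamma>v: "mat_adjoint (\<Gamma> p z) *\<^sub>v v \<in> carrier_vec (ns p)"
    if "p < N" "z \<in> \<Lambda>" "v \<in> carrier_vec n'" for p z and v :: "complex Matrix.vec"
    using mult_mat_vec_carrier[OF mat_adjoint_carrier[OF \<Gamma>[OF that(1,2)]] that(3)] .
  have f_in: "?f p x \<in> hcarrier (Hs p)" if "p < N" "x \<in> set L" for p x
    using kernel_frame.k_in[OF F[OF that(1)] mem(1)[OF that(2)] \<Gamma>v[OF that(1) mem[OF that(2)]]]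
    by (simp add: split_beta)
  have f'_in: "?f' x \<in> hcarrier H'" if "x \<in> set L" for x
    using F'.k_in[OF mem[OF that]] by (simp add: split_beta)
  have sum_in: "(\<Sum>x\<leftarrow>L. ?f p x) \<in> hcarrier (Hs p)" if p: "p < N" for p
  proof -
    interpret kernel_frame "Hs p" "ns p" \<Lambda> "Ts p" "Ss p" "Ks p" "ks p" using F[OF p] .
    show ?thesis using f_in[OF p] by (rule sum_list_closed)
  qed
  have pair: "(\<Sum>p<N. hinner (Hs p) (?f p (w, v)) (?f p (z, u))) = hinner H' (?f' (w, v)) (?f' (z, u))"
    if w: "w \<in> \<Lambda>" and v: "v \<in> carrier_vec n'" and z: "z \<in> \<Lambda>" and u: "u \<in> carrier_vec n'" for w v z u
  proof -
    have K'v: "K' z w *\<^sub>v v \<in> carrier_vec n'"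
      by (rule mult_mat_vec_carrier[OF F'.K_carrier[OF z w] v])
    have "hinner (Hs p) (?f p (w, v)) (?f p (z, u)) = ((\<Gamma> p z * \<Theta> p z) *\<^sub>v (K' z w *\<^sub>v v)) \<bullet>c u"
      if p: "p < N" for p
    proof -
      interpret kernel_frame "Hs p" "ns p" \<Lambda> "Ts p" "Ss p" "Ks p" "ks p" using F[OF p] .
      have "hinner (Hs p) (?f p (w, v)) (?f p (z, u)) =
          (Ks p z w *\<^sub>v (mat_adjoint (\<Gamma> p w) *\<^sub>v v)) \<bullet>c (mat_adjoint (\<Gamma> p z) *\<^sub>v u)"
        using gram[OF z w \<Gamma>v[OF p w v] \<Gamma>v[OF p z u]] by simp
      also have "Ks p z w *\<^sub>v (mat_adjoint (\<Gamma> p w) *\<^sub>v v) = (Ks p z w * mat_adjoint (\<Gamma> p w)) *\<^sub>v v"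
        by (rule assoc_mult_mat_vec[symmetric, OF K_carrier[OF z w] mat_adjoint_carrier[OF \<Gamma>[OF p w]] v])
      also have "\<dots> = \<Theta> p z *\<^sub>v (K' z w *\<^sub>v v)"
        unfolding inter[OF p z w] by (rule assoc_mult_mat_vec[OF \<Theta>[OF p z] F'.K_carrier[OF z w] v])
      also have "\<dots> \<bullet>c (mat_adjoint (\<Gamma> p z) *\<^sub>v u) = (\<Gamma> p z *\<^sub>v (\<Theta> p z *\<^sub>v (K' z w *\<^sub>v v))) \<bullet>c u"
        by (rule cscalar_prod_mat_adjoint[symmetric, OF \<Gamma>[OF p z] mult_mat_vec_carrier[OF \<Theta>[OF p z] K'v] u])
      also have "\<Gamma> p z *\<^sub>v (\<Theta> p z *\<^sub>v (K' z w *\<^sub>v v)) = (\<Gamma> p z * \<Theta> p z) *\<^sub>v (K' z w *\<^sub>v v)"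
        by (rule assoc_mult_mat_vec[symmetric, OF \<Gamma>[OF p z] \<Theta>[OF p z] K'v])
      finally show ?thesis .
    qed
    then have "(\<Sum>p<N. hinner (Hs p) (?f p (w, v)) (?f p (z, u))) = (K' z w *\<^sub>v v) \<bullet>c u"
      using id[OF z u K'v] by simp
    also have "\<dots> = hinner H' (?f' (w, v)) (?f' (z, u))"
      using F'.gram[OF z w v u] by simp
    finally show ?thesis .
  qed
  have "(\<Sum>p<N. hinner (Hs p) (\<Sum>x\<leftarrow>L. ?f p x) (\<Sum>x\<leftarrow>L. ?f p x))
      = (\<Sum>p<N. \<Sum>x\<leftarrow>L. \<Sum>y\<leftarrow>L. hinner (Hs p) (?f p x) (?f p y))"
  proof (intro sum.cong refl)
    fix p assume "p \<in> {..<N}"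
    then have p: "p < N" by simp
    interpret kernel_frame "Hs p" "ns p" \<Lambda> "Ts p" "Ss p" "Ks p" "ks p" using F[OF p] .
    show "hinner (Hs p) (\<Sum>x\<leftarrow>L. ?f p x) (\<Sum>x\<leftarrow>L. ?f p x) = (\<Sum>x\<leftarrow>L. \<Sum>y\<leftarrow>L. hinner (Hs p) (?f p x) (?f p y))"
      by (rule hinner_sum_list) (rule f_in[OF p], assumption)+
  qed
  also have "\<dots> = (\<Sum>x\<leftarrow>L. \<Sum>y\<leftarrow>L. \<Sum>p<N. hinner (Hs p) (?f p x) (?f p y))"
    by (simp only: sum_sum_list_swap)
  also have "\<dots> = (\<Sum>x\<leftarrow>L. \<Sum>y\<leftarrow>L. hinner H' (?f' x) (?f' y))"
  proof (intro arg_cong[where f = sum_list] map_cong refl)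
    fix x y assume "x \<in> set L" "y \<in> set L"
    then show "(\<Sum>p<N. hinner (Hs p) (?f p x) (?f p y)) = hinner H' (?f' x) (?f' y)"
      using pair[of "fst x" "snd x" "fst y" "snd y"] mem[of x] mem[of y] by simp
  qed
  also have "\<dots> = hinner H' (\<Sum>x\<leftarrow>L. ?f' x) (\<Sum>x\<leftarrow>L. ?f' x)"
    by (rule F'.hinner_sum_list[symmetric]) (rule f'_in, assumption)+
  finally have eq: "(\<Sum>p<N. Re (hinner (Hs p) (\<Sum>x\<leftarrow>L. ?f p x) (\<Sum>x\<leftarrow>L. ?f p x)))
      = Re (hinner H' (\<Sum>x\<leftarrow>L. ?f' x) (\<Sum>x\<leftarrow>L. ?f' x))"
    by (metis Re_sum)
  have "0 \<le> Re (hinner (Hs p) (\<Sum>x\<leftarrow>L. ?f p x) (\<Sum>x\<leftarrow>L. ?f p x))" if p: "p < N" for p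
  proof -
    interpret kernel_frame "Hs p" "ns p" \<Lambda> "Ts p" "Ss p" "Ks p" "ks p" using F[OF p] .
    show ?thesis using hinner_nonneg[OF sum_in[OF p]] .
  qed
  then have "Re (hinner (Hs p) (\<Sum>x\<leftarrow>L. ?f p x) (\<Sum>x\<leftarrow>L. ?f p x))
      \<le> (\<Sum>p<N. Re (hinner (Hs p) (\<Sum>x\<leftarrow>L. ?f p x) (\<Sum>x\<leftarrow>L. ?f p x)))"
    using p by (intro member_le_sum) auto
  then show ?thesis unfolding hnorm_def eq by (rule real_sqrt_le_mono)
qed

section \<open>Reproducing kernel realizations as spaces spanned by kernel vectors\<close>

text \<open>Kernel vectors at points of \<open>\<Lambda>\<close> alone are total: an element orthogonal to them is a holomorphic
  function vanishing on \<open>\<Lambda>\<close>, hence on the connected set \<open>\<Omega>\<^sup>*\<close>.\<close>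

lemma kernel_frame_of_realization:
  assumes "open \<Omega>" "connected \<Omega>" and \<Lambda>: "open \<Lambda>" "\<Lambda> \<noteq> {}" "\<Lambda> \<subseteq> conj_set \<Omega>"
    and n: "0 < n" and R: "kernel_realization n \<Omega> H T K"
  shows "kernel_frame H n \<Lambda> T mult_z K (kernel_section n (conj_set \<Omega>) K)"
proof -
  define D where "D = conj_set \<Omega>"
  let ?k = "kernel_section n D K"
  have "D = cnj -` \<Omega>" by (auto simp: D_def conj_set_def)
  then have "open D"
    using \<open>open \<Omega>\<close> by (auto intro!: open_vimage continuous_intros)
  have "D = cnj ` \<Omega>"
    by (force simp: D_def conj_set_def image_iff)
  then have "connected D"
    using \<open>connected \<Omega>\<close> by (auto intro!: connected_continuous_image continuous_intros)
  note D = \<open>open D\<close> \<open>connected D\<close>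
  have R': "separable_hilbert_space H"
    "\<forall>f\<in>hcarrier H. holo_vfun n D f"
    "\<forall>z\<in>D. \<forall>w\<in>D. K z w \<in> carrier_mat n n"
    "\<forall>w\<in>D. \<forall>v\<in>carrier_vec n. ?k w v \<in> hcarrier H \<and>
      (\<forall>f\<in>hcarrier H. hinner H f (?k w v) = Matrix.vec n (f w) \<bullet>c v)"
    "bounded_op H mult_z" "bounded_op H T"
    "\<forall>f\<in>hcarrier H. \<forall>g\<in>hcarrier H. hinner H (mult_z f) g = hinner H f (T g)"
    "\<forall>w\<in>D. eigenspace H T (cnj w) = ?k w ` carrier_vec n"
    "\<forall>w\<in>D. \<forall>v\<in>carrier_vec n. v \<noteq> 0\<^sub>v n \<longrightarrow> 0 < (K w w *\<^sub>v v) \<bullet>c v"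
    using R unfolding kernel_realization_def Let_def D_def[symmetric]
    by - ((elim conjE, assumption)+)
  note H = R'(1) and bdd = R'(5,6)
  have holo: "holo_vfun n D f" if "f \<in> hcarrier H" for f
    using R'(2) that by blast
  have K: "K z w \<in> carrier_mat n n" if "z \<in> D" "w \<in> D" for z w
    using R'(3) that by blast
  have k_in: "?k w v \<in> hcarrier H" if "w \<in> D" "v \<in> carrier_vec n" for w v
    using R'(4) that by blast
  have repr: "hinner H f (?k w v) = Matrix.vec n (f w) \<bullet>c v"
    if "w \<in> D" "v \<in> carrier_vec n" "f \<in> hcarrier H" for w v f
    using R'(4) that by blast
  have adj: "hinner H (mult_z f) g = hinner H f (T g)" if "f \<in> hcarrier H" "g \<in> hcarrier H" for f g
    using R'(7) that by blast
  have eig: "eigenspace H T (cnj w) = ?k w ` carrier_vec n" if "w \<in> D" for w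
    using R'(8) that by blast
  have pos: "0 < (K w w *\<^sub>v v) \<bullet>c v" if "w \<in> D" "v \<in> carrier_vec n" "v \<noteq> 0\<^sub>v n" for w v
    using R'(9) that by blast
  interpret H: separable_hilbert_space H by fact
  have sub: "z \<in> D" if "z \<in> \<Lambda>" for z using \<Lambda>(3) that by (auto simp: D_def)
  have ev: "Matrix.vec n (?k w v z) = K z w *\<^sub>v v" if "z \<in> D" "w \<in> D" "v \<in> carrier_vec n" for z w v
    using K[OF that(1,2)] that by (intro eq_vecI) (auto simp: kernel_section_def)
  have gram: "hinner H (?k w u) (?k z v) = (K z w *\<^sub>v u) \<bullet>c v"
    if "z \<in> D" "w \<in> D" "u \<in> carrier_vec n" "v \<in> carrier_vec n" for z w u v
    using repr[OF that(1,4) k_in[OF that(2,3)]] ev[OF that(1-3)] by simp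
  have "kernel_frame H n \<Lambda> T mult_z K ?k"
  proof (unfold_locales)
    show "0 < n" "\<Lambda> \<noteq> {}" by fact+
    show "linear_op H H T" "linear_op H H mult_z" using bdd by (auto simp: bounded_op_def)
    show "hinner H (mult_z f) g = hinner H f (T g)" if "f \<in> hcarrier H" "g \<in> hcarrier H" for f g
      using adj that .
    show "K z w \<in> carrier_mat n n" if "z \<in> \<Lambda>" "w \<in> \<Lambda>" for z w using K sub that by blast
    show "?k z v \<in> hcarrier H" if "z \<in> \<Lambda>" "v \<in> carrier_vec n" for z v using k_in sub that by blast
    show "?k z (u + v) = ?k z u + ?k z v" if "z \<in> \<Lambda>" "u \<in> carrier_vec n" "v \<in> carrier_vec n" for z u v
    proof (intro ext)
      fix w i
      show "?k z (u + v) w i = (?k z u + ?k z v) w i"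
      proof (cases "w \<in> D \<and> i < n")
        case True
        then have Kc: "K w z \<in> carrier_mat n n" using K sub that by blast
        have "K w z *\<^sub>v (u + v) = K w z *\<^sub>v u + K w z *\<^sub>v v"
          by (rule mult_add_distrib_mat_vec[OF Kc that(2,3)])
        then show ?thesis using True Kc by (simp add: kernel_section_def del: index_mult_mat_vec)
      qed (auto simp: kernel_section_def)
    qed
    show "?k z (a \<cdot>\<^sub>v v) = a *\<^sub>C ?k z v" if "z \<in> \<Lambda>" "v \<in> carrier_vec n" for z v a
    proof (intro ext)
      fix w i
      show "?k z (a \<cdot>\<^sub>v v) w i = (a *\<^sub>C ?k z v) w i"
      proof (cases "w \<in> D \<and> i < n")
        case True
        then have Kc: "K w z \<in> carrier_mat n n" using K sub that by blast
        have "K w z *\<^sub>v (a \<cdot>\<^sub>v v) = a \<cdot>\<^sub>v (K w z *\<^sub>v v)"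
          by (rule mult_mat_vec[OF Kc that(2)])
        then show ?thesis
          using True Kc by (simp add: kernel_section_def scaleC_fun_def scaleC_complex_def del: index_mult_mat_vec)
      qed (auto simp: kernel_section_def scaleC_fun_def scaleC_complex_def)
    qed
    show "?k z v \<noteq> 0" if "z \<in> \<Lambda>" "v \<in> carrier_vec n" "v \<noteq> 0\<^sub>v n" for z v
    proof
      assume "?k z v = 0"
      then have "hinner H (?k z v) (?k z v) = 0" by (simp add: H.hinner_zero_left H.hcarrier_closed)
      then show False
        using gram[OF sub sub, OF that(1) that(1) that(2) that(2)] pos[OF sub[OF that(1)] that(2,3)] by simp
    qed
    show "T (?k z v) = cnj z *\<^sub>C ?k z v" if "z \<in> \<Lambda>" "v \<in> carrier_vec n" for z v
    proof -
      have "?k z v \<in> eigenspace H T (cnj z)" using eig[OF sub[OF that(1)]] that(2) by blast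
      then show ?thesis by (simp add: eigenspace_def)
    qed
    show "hinner H (?k w u) (?k z v) = (K z w *\<^sub>v u) \<bullet>c v"
      if "z \<in> \<Lambda>" "w \<in> \<Lambda>" "u \<in> carrier_vec n" "v \<in> carrier_vec n" for z w u v
      using gram[OF sub sub] that by blast
    have "f = 0" if f: "f \<in> horth H (frame_set n \<Lambda> ?k)" for f
    proof -
      have fH: "f \<in> hcarrier H" using f by (simp add: horth_def)
      have zero: "f z i = 0" if z: "z \<in> \<Lambda>" and i: "i < n" for z i
      proof -
        have "Matrix.vec n (f z) \<bullet>c unit_vec n i = 0"
        proof -
          have "?k z (unit_vec n i) \<in> frame_set n \<Lambda> ?k"
            unfolding frame_set_def using z unit_vec_carrier by blast
          then have "hinner H f (?k z (unit_vec n i)) = 0" using f by (simp add: horth_def)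
          then show ?thesis using repr[OF sub[OF z] unit_vec_carrier fH, of i] by simp
        qed
        moreover have "conjugate (unit_vec n i) = (unit_vec n i :: complex Matrix.vec)"
          by (intro eq_vecI) (auto simp: unit_vec_def)
        ultimately show ?thesis using i by (simp add: scalar_prod_right_unit)
      qed
      have "f z i = 0" for z i
      proof (cases "z \<in> D \<and> i < n")
        case True
        then have hol: "(\<lambda>z. f z i) holomorphic_on D"
          using holo[OF fH] by (simp add: holo_vfun_def)
        show ?thesis
          by (rule analytic_continuation_open[of \<Lambda> D "\<lambda>z. f z i" "\<lambda>_. 0"])
            (use \<Lambda> D hol zero True D_def in auto)
      next
        case False
        then show ?thesis using holo[OF fH] by (auto simp: holo_vfun_def)
      qed
      then show ?thesis by (intro ext) simp
    qed
    moreover have "0 \<in> horth H (frame_set n \<Lambda> ?k)"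
      using k_in sub by (auto simp: horth_def frame_set_def H.hcarrier_closed H.hinner_zero_left)
    ultimately show "horth H (frame_set n \<Lambda> ?k) = {0}" by blast
  qed
  then show ?thesis unfolding D_def .
qed

section \<open>Unitary equivalence and repeated blocks\<close>

lemma unitarily_equivalent_trans:
  assumes 1: "unitarily_equivalent H1 T1 H2 T2" and 2: "unitarily_equivalent H2 T2 H3 T3"
  shows "unitarily_equivalent H1 T1 H3 T3"
proof -
  obtain U where U: "linear_op H1 H2 U" "bij_betw U (hcarrier H1) (hcarrier H2)"
    "\<And>x y. \<lbrakk>x \<in> hcarrier H1; y \<in> hcarrier H1\<rbrakk> \<Longrightarrow> hinner H2 (U x) (U y) = hinner H1 x y"
    "\<And>x. x \<in> hcarrier H1 \<Longrightarrow> U (T1 x) = T2 (U x)"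
    using 1 unfolding unitarily_equivalent_def by blast
  obtain V where V: "linear_op H2 H3 V" "bij_betw V (hcarrier H2) (hcarrier H3)"
    "\<And>x y. \<lbrakk>x \<in> hcarrier H2; y \<in> hcarrier H2\<rbrakk> \<Longrightarrow> hinner H3 (V x) (V y) = hinner H2 x y"
    "\<And>x. x \<in> hcarrier H2 \<Longrightarrow> V (T2 x) = T3 (V x)"
    using 2 unfolding unitarily_equivalent_def by blast
  have in2: "U x \<in> hcarrier H2" if "x \<in> hcarrier H1" for x
    using U(1) that by (simp add: linear_op_def)
  show ?thesis
    unfolding unitarily_equivalent_def
  proof (intro exI[of _ "V \<circ> U"] conjI ballI)
    show "linear_op H1 H3 (V \<circ> U)"
      using U(1) V(1) by (simp add: linear_op_def)
    show "bij_betw (V \<circ> U) (hcarrier H1) (hcarrier H3)"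
      using U(2) V(2) by (rule bij_betw_trans)
  qed (use U(3,4) V(3,4) in2 in simp_all)
qed

lemma copies_eq_map: "copies t m X = map X (copies t m (\<lambda>i. i))"
  by (simp add: copies_def map_concat comp_def)

lemma length_copies: "length (copies t m X) = (\<Sum>i<t. m i)"
  by (induction t) (simp_all add: copies_def)

lemma set_copies: "set (copies t m (\<lambda>i. i)) \<subseteq> {..<t}"
  by (auto simp: copies_def)

lemma sum_list_copies: "sum_list (copies t m d) = (\<Sum>i<t. m i * d i :: nat)"
  by (induction t) (simp_all add: copies_def sum_list_replicate)

lemma sum_list_map_upt: "sum_list (map f [0..<t]) = (\<Sum>i<t. f i :: nat)"
  by (induction t) simp_all

text \<open>Position \<open>a\<close> in the \<open>i\<close>-th group of \<open>m i\<close> blocks of size \<open>d i\<close> lies in the copy number \<open>a div d i\<close>.\<close>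

lemma group_index_cases:
  assumes i: "i < t" and a: "a < m i * d i"
  obtains p a' where "p < length (copies t m d)" "copies t m (\<lambda>i. i) ! p = i" "a' < d i"
    "sum_list (take i (map (\<lambda>i. m i * d i) [0..<t])) + a = sum_list (take p (copies t m d)) + a'"
proof -
  have pos: "0 < d i" using a by (cases "d i") auto
  define r where "r = a div d i"
  have r: "r < m i" using a by (simp add: r_def less_mult_imp_div_less)
  define p where "p = (\<Sum>i<i. m i) + r"
  have split: "copies t m X = copies i m X @ replicate (m i) (X i) @
      concat (map (\<lambda>i. replicate (m i) (X i)) [Suc i..<t])" for X :: "nat \<Rightarrow> nat"
  proof -
    have "[0..<t] = [0..<i] @ i # [Suc i..<t]"
      using i by (metis less_imp_le_nat upt_add_eq_append upt_conv_Cons le0 le_add_diff_inverse plus_nat.add_0)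
    then show ?thesis by (simp add: copies_def)
  qed
  show ?thesis
  proof (rule that)
    show "p < length (copies t m d)"
      unfolding split using r by (simp add: p_def length_copies)
    show "copies t m (\<lambda>i. i) ! p = i"
      unfolding split using r by (simp add: p_def length_copies nth_append)
    show "a mod d i < d i" using pos by simp
    have "take i (map (\<lambda>i. m i * d i) [0..<t]) = map (\<lambda>i. m i * d i) [0..<i]"
      using i by (simp add: take_map)
    moreover have "sum_list (take p (copies t m d)) = (\<Sum>i<i. m i * d i) + r * d i"
      unfolding split using r by (simp add: p_def length_copies sum_list_copies sum_list_replicate)
    ultimately show "sum_list (take i (map (\<lambda>i. m i * d i) [0..<t])) + a =
        sum_list (take p (copies t m d)) + a mod d i"
      by (simp add: sum_list_map_upt r_def)
  qed
qed

section \<open>The blocks of an intertwining matrix function\<close>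

theorem mainTheorem3:
  fixes \<Omega> \<Lambda> :: "complex set"
    and n t k :: nat
    and H H' :: "(nat \<Rightarrow> vfun) ip_space"
    and T T' :: "(nat \<Rightarrow> vfun) \<Rightarrow> (nat \<Rightarrow> vfun)"
    and m l d d' :: "nat \<Rightarrow> nat"
    and Hi Hi' :: "nat \<Rightarrow> vfun ip_space"
    and Ti Ti' :: "nat \<Rightarrow> vfun \<Rightarrow> vfun"
    and Ki Ki' :: "nat \<Rightarrow> complex \<Rightarrow> complex \<Rightarrow> complex mat"
    and \<pi> :: "nat \<Rightarrow> nat"
    and \<Phi> :: "complex \<Rightarrow> complex mat"
  assumes "open \<Omega>" and "connected \<Omega>"
    and "IR_decomposition n \<Omega> H T t m d Hi Ti"
    and "IR_decomposition n \<Omega> H' T' t l d' Hi' Ti'"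
    and "unitarily_equivalent H' T' H T"
    and "\<pi> permutes {..<t}"
    and "\<forall>i<t. unitarily_equivalent (Hi i) (Ti i) (Hi' (\<pi> i)) (Ti' (\<pi> i)) \<and> m i = l (\<pi> i)"
    and "k = (\<Sum>i<t. m i)" and "k = (\<Sum>i<t. l i)"
    and "\<forall>i<t. kernel_realization (d i) \<Omega> (Hi i) (Ti i) (Ki i)"
    and "\<forall>i<t. kernel_realization (d' i) \<Omega> (Hi' i) (Ti' i) (Ki' i)"
    and "open \<Lambda>" and "\<Lambda> \<noteq> {}" and "\<Lambda> \<subseteq> conj_set \<Omega>"
    and "\<forall>\<mu>\<in>\<Lambda>. \<Phi> \<mu> \<in> carrier_mat n n \<and> invertible_mat (\<Phi> \<mu>)"
    and "\<forall>a<n. \<forall>b<n. (\<lambda>\<mu>. \<Phi> \<mu> $$ (a, b)) holomorphic_on \<Lambda>"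
    and "\<forall>\<mu>\<in>\<Lambda>. \<forall>\<nu>\<in>\<Lambda>. diag_kernel (copies t m Ki) \<mu> \<nu> =
           \<Phi> \<mu> * diag_kernel (copies t l Ki') \<mu> \<nu> * mat_adjoint (\<Phi> \<nu>)"
  defines "block \<equiv> \<lambda>\<mu>. mat_block (copies t m d) (copies t l d') (\<Phi> \<mu>)"
    and "group_block \<equiv> \<lambda>\<mu>. mat_block (map (\<lambda>i. m i * d i) [0..<t]) (map (\<lambda>j. l j * d' j) [0..<t]) (\<Phi> \<mu>)"
  shows "(\<forall>i<t. (\<exists>\<mu>\<in>\<Lambda>. group_block \<mu> i (\<pi> i) \<noteq> 0\<^sub>m (m i * d i) (l (\<pi> i) * d' (\<pi> i))) \<and>
            (\<forall>j<t. j \<noteq> \<pi> i \<longrightarrow> (\<forall>\<mu>\<in>\<Lambda>. group_block \<mu> i j = 0\<^sub>m (m i * d i) (l j * d' j)))) \<and>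
         (\<forall>p<k. \<forall>q<k. (\<forall>\<mu>\<in>\<Lambda>. invertible_mat (block \<mu> p q)) \<or>
            (\<forall>\<mu>\<in>\<Lambda>. block \<mu> p q = 0\<^sub>m (copies t m d ! p) (copies t l d' ! q)))"
proof -
  define I J where "I = copies t m (\<lambda>i. i)" and "J = copies t l (\<lambda>i. i)"
  define rs cs where "rs = copies t m d" and "cs = copies t l d'"
  define D where "D = conj_set \<Omega>"
  note \<Omega> = \<open>open \<Omega>\<close> \<open>connected \<Omega>\<close> and \<Lambda> = \<open>open \<Lambda>\<close> \<open>\<Lambda> \<noteq> {}\<close> \<open>\<Lambda> \<subseteq> conj_set \<Omega>\<close>
  note IR = \<open>IR_decomposition n \<Omega> H T t m d Hi Ti\<close>[unfolded IR_decomposition_def]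
  note IR' = \<open>IR_decomposition n \<Omega> H' T' t l d' Hi' Ti'\<close>[unfolded IR_decomposition_def]
  have m_pos: "0 < m i" and d_pos: "0 < d i" and irr: "irreducible_op (Hi i) (Ti i)" if "i < t" for i
    using IR that by (auto simp: cowen_douglas_def)
  have d'_pos: "0 < d' i" and irr': "irreducible_op (Hi' i) (Ti' i)" if "i < t" for i
    using IR' that by (auto simp: cowen_douglas_def)
  have n_eq: "(\<Sum>i<t. m i * d i) = n" "(\<Sum>i<t. l i * d' i) = n"
    using IR IR' by auto
  have inequiv': "i = j" if "i < t" "j < t" "unitarily_equivalent (Hi' i) (Ti' i) (Hi' j) (Ti' j)" for i j
    using IR' that by blast
  have len: "length I = k" "length J = k" "length rs = k" "length cs = k"
    using \<open>k = (\<Sum>i<t. m i)\<close> \<open>k = (\<Sum>i<t. l i)\<close> by (simp_all add: I_def J_def rs_def cs_def length_copies)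
  have I: "I ! p < t" if "p < k" for p
  proof -
    have "I ! p \<in> set I" using that len by simp
    then show ?thesis using set_copies[of t m] unfolding I_def by blast
  qed
  have J: "J ! q < t" if "q < k" for q
  proof -
    have "J ! q \<in> set J" using that len by simp
    then show ?thesis using set_copies[of t l] unfolding J_def by blast
  qed
  have rs_I: "rs = map d I" and cs_J: "cs = map d' J"
    unfolding rs_def cs_def I_def J_def by (rule copies_eq_map)+
  have sums: "sum_list rs = n" "sum_list cs = n"
    using n_eq by (simp_all add: rs_def cs_def sum_list_copies)
  have frame: "kernel_frame (Hi i) (d i) \<Lambda> (Ti i) mult_z (Ki i) (kernel_section (d i) D (Ki i))"
    if "i < t" for i
    unfolding D_def
    using \<open>\<forall>i<t. kernel_realization (d i) \<Omega> (Hi i) (Ti i) (Ki i)\<close> that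
    by (intro kernel_frame_of_realization \<Omega> \<Lambda> d_pos) auto
  have frame': "kernel_frame (Hi' i) (d' i) \<Lambda> (Ti' i) mult_z (Ki' i) (kernel_section (d' i) D (Ki' i))"
    if "i < t" for i
    unfolding D_def
    using \<open>\<forall>i<t. kernel_realization (d' i) \<Omega> (Hi' i) (Ti' i) (Ki' i)\<close> that
    by (intro kernel_frame_of_realization \<Omega> \<Lambda> d'_pos) auto
  have \<Phi>: "\<Phi> z \<in> carrier_mat n n" "invertible_mat (\<Phi> z)" if "z \<in> \<Lambda>" for z
    using \<open>\<forall>\<mu>\<in>\<Lambda>. \<Phi> \<mu> \<in> carrier_mat n n \<and> invertible_mat (\<Phi> \<mu>)\<close> that by auto
  have "\<exists>B. B \<in> carrier_mat n n \<and> \<Phi> z * B = 1\<^sub>m n \<and> B * \<Phi> z = 1\<^sub>m n" if z: "z \<in> \<Lambda>" for z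
  proof -
    obtain B where B: "\<Phi> z * B = 1\<^sub>m n" "B * \<Phi> z = 1\<^sub>m (dim_row B)"
      using \<Phi>[OF z] by (auto simp: invertible_mat_def inverts_mat_def)
    have "dim_col B = n" using arg_cong[OF B(1), of dim_col] by simp
    moreover have "dim_row B = n" using arg_cong[OF B(2), of dim_col] \<Phi>(1)[OF z] by simp
    ultimately show ?thesis using B by (intro exI[of _ B]) auto
  qed
  then obtain \<Gamma> where \<Gamma>: "\<And>z. z \<in> \<Lambda> \<Longrightarrow> \<Gamma> z \<in> carrier_mat n n"
    and \<Phi>\<Gamma>: "\<And>z. z \<in> \<Lambda> \<Longrightarrow> \<Phi> z * \<Gamma> z = 1\<^sub>m n" and \<Gamma>\<Phi>: "\<And>z. z \<in> \<Lambda> \<Longrightarrow> \<Gamma> z * \<Phi> z = 1\<^sub>m n"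
    by metis
  define Ds Ds' where "Ds z w = map (\<lambda>i. Ki i z w) I" and "Ds' z w = map (\<lambda>i. Ki' i z w) J" for z w
  have K_diag: "diag_kernel (copies t m Ki) z w = diag_block_mat (Ds z w)"
    and K'_diag: "diag_kernel (copies t l Ki') z w = diag_block_mat (Ds' z w)" for z w
    unfolding diag_kernel_def copies_eq_map[of t m Ki] copies_eq_map[of t l Ki']
    by (simp_all add: Ds_def Ds'_def I_def J_def comp_def)
  have Kp: "dim_row (Ki (I ! p) z w) = d (I ! p)" "dim_col (Ki (I ! p) z w) = d (I ! p)"
    if "p < k" "z \<in> \<Lambda>" "w \<in> \<Lambda>" for p z w
    using carrier_matD[OF kernel_frame.K_carrier[OF frame[OF I[OF that(1)]] that(2,3)]] .
  have K'q: "dim_row (Ki' (J ! q) z w) = d' (J ! q)" "dim_col (Ki' (J ! q) z w) = d' (J ! q)"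
    if "q < k" "z \<in> \<Lambda>" "w \<in> \<Lambda>" for q z w
    using carrier_matD[OF kernel_frame.K_carrier[OF frame'[OF J[OF that(1)]] that(2,3)]] .
  have Ds: "dim_col X = dim_row X" if zw: "z \<in> \<Lambda>" "w \<in> \<Lambda>" and X: "X \<in> set (Ds z w)" for z w X
    using X len Kp[OF _ zw] by (auto simp: Ds_def in_set_conv_nth)
  have Ds': "dim_col X = dim_row X" if zw: "z \<in> \<Lambda>" "w \<in> \<Lambda>" and X: "X \<in> set (Ds' z w)" for z w X
    using X len K'q[OF _ zw] by (auto simp: Ds'_def in_set_conv_nth)
  have rows: "rs = map dim_row (Ds z w)" "cs = map dim_row (Ds' z w)" if zw: "z \<in> \<Lambda>" "w \<in> \<Lambda>" for z w
  proof -
    show "rs = map dim_row (Ds z w)"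
      using Kp[OF _ zw] len by (intro nth_equalityI) (auto simp: rs_I Ds_def)
    show "cs = map dim_row (Ds' z w)"
      using K'q[OF _ zw] len by (intro nth_equalityI) (auto simp: cs_J Ds'_def)
  qed
  have K: "diag_block_mat (Ds z w) \<in> carrier_mat n n" and K': "diag_block_mat (Ds' z w) \<in> carrier_mat n n"
    if zw: "z \<in> \<Lambda>" "w \<in> \<Lambda>" for z w
  proof -
    show "diag_block_mat (Ds z w) \<in> carrier_mat n n"
      using diag_block_mat_carrier[of "Ds z w", unfolded rows(1)[OF zw, symmetric] sums] Ds[OF zw] by blast
    show "diag_block_mat (Ds' z w) \<in> carrier_mat n n"
      using diag_block_mat_carrier[of "Ds' z w", unfolded rows(2)[OF zw, symmetric] sums] Ds'[OF zw] by blast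
  qed
  have main: "diag_block_mat (Ds z w) = \<Phi> z * diag_block_mat (Ds' z w) * mat_adjoint (\<Phi> w)"
    if "z \<in> \<Lambda>" "w \<in> \<Lambda>" for z w
    using \<open>\<forall>\<mu>\<in>\<Lambda>. \<forall>\<nu>\<in>\<Lambda>. diag_kernel (copies t m Ki) \<mu> \<nu> = _\<close> that by (simp add: K_diag K'_diag)
  have adj_one: "mat_adjoint (1\<^sub>m n) = (1\<^sub>m n :: complex mat)"
    by (rule eq_matI) auto
  \<comment> \<open>the kernel equation multiplied by \<open>\<Gamma>(w)\<^sup>*\<close> from the right, and below by \<open>\<Gamma>(z)\<close> from the left\<close>
  have K\<Gamma>: "diag_block_mat (Ds z w) * mat_adjoint (\<Gamma> w) = \<Phi> z * diag_block_mat (Ds' z w)"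
    if zw: "z \<in> \<Lambda>" "w \<in> \<Lambda>" for z w
  proof -
    have "mat_adjoint (\<Phi> w) * mat_adjoint (\<Gamma> w) = 1\<^sub>m n"
      using mat_adjoint_mult[OF \<Gamma>[OF zw(2)] \<Phi>(1)[OF zw(2)]] \<Gamma>\<Phi>[OF zw(2)] adj_one by simp
    moreover have "diag_block_mat (Ds z w) * mat_adjoint (\<Gamma> w) =
        \<Phi> z * diag_block_mat (Ds' z w) * (mat_adjoint (\<Phi> w) * mat_adjoint (\<Gamma> w))"
      unfolding main[OF zw]
      by (rule assoc_mult_mat[OF mult_carrier_mat[OF \<Phi>(1)[OF zw(1)] K'[OF zw]]
            mat_adjoint_carrier[OF \<Phi>(1)[OF zw(2)]] mat_adjoint_carrier[OF \<Gamma>[OF zw(2)]]])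
    ultimately show ?thesis
      using right_mult_one_mat[OF mult_carrier_mat[OF \<Phi>(1)[OF zw(1)] K'[OF zw]]] by simp
  qed
  have \<Gamma>K: "diag_block_mat (Ds' z w) * mat_adjoint (\<Phi> w) = \<Gamma> z * diag_block_mat (Ds z w)"
    if zw: "z \<in> \<Lambda>" "w \<in> \<Lambda>" for z w
  proof -
    have R: "diag_block_mat (Ds' z w) * mat_adjoint (\<Phi> w) \<in> carrier_mat n n"
      by (rule mult_carrier_mat[OF K'[OF zw] mat_adjoint_carrier[OF \<Phi>(1)[OF zw(2)]]])
    have "diag_block_mat (Ds z w) = \<Phi> z * (diag_block_mat (Ds' z w) * mat_adjoint (\<Phi> w))"
      unfolding main[OF zw]
      by (rule assoc_mult_mat[OF \<Phi>(1)[OF zw(1)] K'[OF zw] mat_adjoint_carrier[OF \<Phi>(1)[OF zw(2)]]])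
    then have "\<Gamma> z * diag_block_mat (Ds z w) = \<Gamma> z * \<Phi> z * (diag_block_mat (Ds' z w) * mat_adjoint (\<Phi> w))"
      using assoc_mult_mat[OF \<Gamma>[OF zw(1)] \<Phi>(1)[OF zw(1)] R] by simp
    then show ?thesis using left_mult_one_mat[OF R] by (simp add: \<Gamma>\<Phi>[OF zw(1)])
  qed
  \<comment> \<open>multiplication by \<open>\<Psi> p q\<close> is going to be the adjoint of multiplication by \<open>\<Theta> p q\<close>\<close>
  define \<Theta> where "\<Theta> p q z = mat_block rs cs (\<Phi> z) p q" for p q z
  define \<Psi> where "\<Psi> p q z = mat_block cs rs (\<Gamma> z) q p" for p q z
  have \<Theta>_c: "\<Theta> p q z \<in> carrier_mat (d (I ! p)) (d' (J ! q))"
    and \<Psi>_c: "\<Psi> p q z \<in> carrier_mat (d' (J ! q)) (d (I ! p))" if "p < k" "q < k" for p q z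
    using that len mat_block_carrier[of rs cs "\<Phi> z" p q] mat_block_carrier[of cs rs "\<Gamma> z" q p]
    by (simp_all add: \<Theta>_def \<Psi>_def rs_I cs_J)
  have inter: "Ki (I ! p) z w * mat_adjoint (\<Psi> p q w) = \<Theta> p q z * Ki' (J ! q) z w"
    if p: "p < k" and q: "q < k" and zw: "z \<in> \<Lambda>" "w \<in> \<Lambda>" for p q z w
  proof -
    have "mat_block rs cs (diag_block_mat (Ds z w) * mat_adjoint (\<Gamma> w)) p q
        = Ds z w ! p * mat_block rs cs (mat_adjoint (\<Gamma> w)) p q"
      by (rule diag_block_mat_mult_mat_block)
        (use Ds[OF zw] rows(1)[OF zw] \<Gamma>[OF zw(2)] sums p q len in \<open>auto simp: Ds_def\<close>)
    also have "mat_block rs cs (mat_adjoint (\<Gamma> w)) p q = mat_adjoint (\<Psi> p q w)"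
      unfolding \<Psi>_def by (rule mat_block_mat_adjoint) (use \<Gamma>[OF zw(2)] sums p q len in auto)
    finally have 1: "mat_block rs cs (diag_block_mat (Ds z w) * mat_adjoint (\<Gamma> w)) p q
        = Ds z w ! p * mat_adjoint (\<Psi> p q w)" .
    have 2: "mat_block rs cs (\<Phi> z * diag_block_mat (Ds' z w)) p q = \<Theta> p q z * Ds' z w ! q"
      unfolding \<Theta>_def
      by (rule mat_block_mult_diag_block_mat)
        (use Ds'[OF zw] rows(2)[OF zw] \<Phi>(1)[OF zw(1)] sums p q len in \<open>auto simp: Ds'_def\<close>)
    show ?thesis using 1 2 K\<Gamma>[OF zw] p q len by (simp add: Ds_def Ds'_def)
  qed
  have inter': "Ki' (J ! q) z w * mat_adjoint (\<Theta> p q w) = \<Psi> p q z * Ki (I ! p) z w"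
    if p: "p < k" and q: "q < k" and zw: "z \<in> \<Lambda>" "w \<in> \<Lambda>" for p q z w
  proof -
    have "mat_block cs rs (diag_block_mat (Ds' z w) * mat_adjoint (\<Phi> w)) q p
        = Ds' z w ! q * mat_block cs rs (mat_adjoint (\<Phi> w)) q p"
      by (rule diag_block_mat_mult_mat_block)
        (use Ds'[OF zw] rows(2)[OF zw] \<Phi>(1)[OF zw(2)] sums p q len in \<open>auto simp: Ds'_def\<close>)
    also have "mat_block cs rs (mat_adjoint (\<Phi> w)) q p = mat_adjoint (\<Theta> p q w)"
      unfolding \<Theta>_def by (rule mat_block_mat_adjoint) (use \<Phi>(1)[OF zw(2)] sums p q len in auto)
    finally have 1: "mat_block cs rs (diag_block_mat (Ds' z w) * mat_adjoint (\<Phi> w)) q p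
        = Ds' z w ! q * mat_adjoint (\<Theta> p q w)" .
    have 2: "mat_block cs rs (\<Gamma> z * diag_block_mat (Ds z w)) q p = \<Psi> p q z * Ds z w ! p"
      unfolding \<Psi>_def
      by (rule mat_block_mult_diag_block_mat)
        (use Ds[OF zw] rows(1)[OF zw] \<Gamma>[OF zw(1)] sums p q len in \<open>auto simp: Ds_def\<close>)
    show ?thesis using 1 2 \<Gamma>K[OF zw] p q len by (simp add: Ds_def Ds'_def)
  qed
  have id: "(\<Sum>p<k. ((\<Psi> p q z * \<Theta> p q z) *\<^sub>v v) \<bullet>c u) = v \<bullet>c u"
    if "q < k" "z \<in> \<Lambda>" "u \<in> carrier_vec (d' (J ! q))" "v \<in> carrier_vec (d' (J ! q))" for q z u v
    using sum_mat_block_inverse[of "\<Gamma> z" cs rs "\<Phi> z" q v u] \<Gamma>[OF that(2)] \<Phi>(1)[OF that(2)]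
      \<Gamma>\<Phi>[OF that(2)] sums len that by (simp add: \<Theta>_def \<Psi>_def cs_J)
  have id': "(\<Sum>q<k. ((\<Theta> p q z * \<Psi> p q z) *\<^sub>v v) \<bullet>c u) = v \<bullet>c u"
    if "p < k" "z \<in> \<Lambda>" "u \<in> carrier_vec (d (I ! p))" "v \<in> carrier_vec (d (I ! p))" for p z u v
    using sum_mat_block_inverse[of "\<Phi> z" rs cs "\<Gamma> z" p v u] \<Gamma>[OF that(2)] \<Phi>(1)[OF that(2)]
      \<Phi>\<Gamma>[OF that(2)] sums len that by (simp add: \<Theta>_def \<Psi>_def rs_I)
  have dichotomy: "(\<forall>z\<in>\<Lambda>. \<Theta> p q z = 0\<^sub>m (d (I ! p)) (d' (J ! q))) \<or>
      (\<forall>z\<in>\<Lambda>. invertible_mat (\<Theta> p q z)) \<and>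
      unitarily_equivalent (Hi' (J ! q)) (Ti' (J ! q)) (Hi (I ! p)) (Ti (I ! p))"
    if p: "p < k" and q: "q < k" for p q
  proof -
    interpret frame_pair "Hi (I ! p)" "d (I ! p)" \<Lambda> "Ti (I ! p)" mult_z "Ki (I ! p)"
        "kernel_section (d (I ! p)) D (Ki (I ! p))"
        "Hi' (J ! q)" "d' (J ! q)" "Ti' (J ! q)" mult_z "Ki' (J ! q)"
        "kernel_section (d' (J ! q)) D (Ki' (J ! q))"
      by (rule frame_pair.intro[OF frame[OF I[OF p]] frame'[OF J[OF q]]])
    show ?thesis
    proof (rule multiplier_dichotomy)
      show "\<Theta> p q z \<in> carrier_mat (d (I ! p)) (d' (J ! q))" "\<Psi> p q z \<in> carrier_mat (d' (J ! q)) (d (I ! p))" for z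
        using \<Theta>_c[OF p q] \<Psi>_c[OF p q] by auto
      show "Ki (I ! p) z w * mat_adjoint (\<Psi> p q w) = \<Theta> p q z * Ki' (J ! q) z w"
        if "z \<in> \<Lambda>" "w \<in> \<Lambda>" for z w
        using inter[OF p q that] .
      show "irreducible_op (Hi (I ! p)) (Ti (I ! p))" "irreducible_op (Hi' (J ! q)) (Ti' (J ! q))"
        using irr[OF I[OF p]] irr'[OF J[OF q]] by auto
    next
      fix L :: "(complex \<times> complex Matrix.vec) list"
      assume L: "set L \<subseteq> \<Lambda> \<times> carrier_vec (d' (J ! q))"
      show "hnorm (Hi (I ! p)) (\<Sum>(z, v)\<leftarrow>L. kernel_section (d (I ! p)) D (Ki (I ! p)) z (mat_adjoint (\<Psi> p q z) *\<^sub>v v))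
          \<le> hnorm (Hi' (J ! q)) (\<Sum>(z, v)\<leftarrow>L. kernel_section (d' (J ! q)) D (Ki' (J ! q)) z v)"
        by (rule multiplier_column_contraction[where N = k and p = p and
              \<Gamma> = "\<lambda>p. \<Psi> p q" and \<Theta> = "\<lambda>p. \<Theta> p q" and Hs = "\<lambda>p. Hi (I ! p)" and
              ks = "\<lambda>p. kernel_section (d (I ! p)) D (Ki (I ! p))",
              OF frame[OF I] frame'[OF J[OF q]] \<Theta>_c[OF _ q] \<Psi>_c[OF _ q] inter[OF _ q] id[OF q] L p])
    next
      fix L :: "(complex \<times> complex Matrix.vec) list"
      assume L: "set L \<subseteq> \<Lambda> \<times> carrier_vec (d (I ! p))"
      show "hnorm (Hi' (J ! q)) (\<Sum>(z, v)\<leftarrow>L. kernel_section (d' (J ! q)) D (Ki' (J ! q)) z (mat_adjoint (\<Theta> p q z) *\<^sub>v v))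
          \<le> hnorm (Hi (I ! p)) (\<Sum>(z, v)\<leftarrow>L. kernel_section (d (I ! p)) D (Ki (I ! p)) z v)"
        by (rule multiplier_column_contraction[where N = k and p = q and
              \<Gamma> = "\<lambda>q. \<Theta> p q" and \<Theta> = "\<lambda>q. \<Psi> p q" and Hs = "\<lambda>q. Hi' (J ! q)" and
              ks = "\<lambda>q. kernel_section (d' (J ! q)) D (Ki' (J ! q))",
              OF frame'[OF J] frame[OF I[OF p]] \<Psi>_c[OF p] \<Theta>_c[OF p] inter'[OF p] id'[OF p] L q])
    qed
  qed
  \<comment> \<open>the other alternative would make the distinct summands \<open>J ! q\<close> and \<open>\<pi> (I ! p)\<close> of the second
    decomposition unitarily equivalent\<close>
  have zero_block: "\<Theta> p q z = 0\<^sub>m (d (I ! p)) (d' (J ! q))"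
    if pq: "p < k" "q < k" and ne: "J ! q \<noteq> \<pi> (I ! p)" and z: "z \<in> \<Lambda>" for p q z
  proof -
    have "\<pi> (I ! p) < t"
      using permutes_in_image[OF \<open>\<pi> permutes {..<t}\<close>, of "I ! p"] I[OF pq(1)] by simp
    moreover have "unitarily_equivalent (Hi (I ! p)) (Ti (I ! p)) (Hi' (\<pi> (I ! p))) (Ti' (\<pi> (I ! p)))"
      using \<open>\<forall>i<t. unitarily_equivalent _ _ _ _ \<and> _\<close> I[OF pq(1)] by blast
    ultimately have "\<not> unitarily_equivalent (Hi' (J ! q)) (Ti' (J ! q)) (Hi (I ! p)) (Ti (I ! p))"
      using inequiv'[OF J[OF pq(2)]] ne unitarily_equivalent_trans by blast
    then show ?thesis using dichotomy[OF pq] z by blast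
  qed
  have zero_group: "group_block z i j = 0\<^sub>m (m i * d i) (l j * d' j)"
    if i: "i < t" and j: "j < t" and ne: "j \<noteq> \<pi> i" and z: "z \<in> \<Lambda>" for z i j
  proof (rule eq_matI)
    fix a b assume "a < dim_row (0\<^sub>m (m i * d i) (l j * d' j) :: complex mat)"
      "b < dim_col (0\<^sub>m (m i * d i) (l j * d' j) :: complex mat)"
    then have a: "a < m i * d i" and b: "b < l j * d' j" by simp_all
    obtain p a' where p: "p < k" "I ! p = i" "a' < d i"
      "sum_list (take i (map (\<lambda>i. m i * d i) [0..<t])) + a = sum_list (take p rs) + a'"
      using group_index_cases[where m = m and d = d, OF i a] len by (auto simp: I_def rs_def)
    obtain q b' where q: "q < k" "J ! q = j" "b' < d' j"
      "sum_list (take j (map (\<lambda>j. l j * d' j) [0..<t])) + b = sum_list (take q cs) + b'"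
      using group_index_cases[where m = l and d = d', OF j b] len by (auto simp: J_def cs_def)
    have "rs ! p = d i" "cs ! q = d' j" using p q len by (simp_all add: rs_I cs_J)
    then have "group_block z i j $$ (a, b) = \<Theta> p q z $$ (a', b')"
      using a b i j p q by (simp add: group_block_def \<Theta>_def)
    then show "group_block z i j $$ (a, b) = 0\<^sub>m (m i * d i) (l j * d' j) $$ (a, b)"
      using zero_block[OF p(1) q(1) _ z] p q ne a b by simp
  qed (use i j in \<open>simp_all add: group_block_def\<close>)
  \<comment> \<open>otherwise a whole group of rows of the invertible matrix \<open>\<Phi> z\<close> would vanish\<close>
  have nonzero_group: "\<exists>z\<in>\<Lambda>. group_block z i (\<pi> i) \<noteq> 0\<^sub>m (m i * d i) (l (\<pi> i) * d' (\<pi> i))"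
    if i: "i < t" for i
  proof (rule ccontr)
    assume "\<not> ?thesis"
    then have zero: "group_block z i j = 0\<^sub>m (m i * d i) (l j * d' j)" if "j < t" "z \<in> \<Lambda>" for z j
      using zero_group[OF i] that by blast
    obtain z where z: "z \<in> \<Lambda>" using \<Lambda>(2) by blast
    let ?rg = "map (\<lambda>i. m i * d i) [0..<t]" and ?cg = "map (\<lambda>j. l j * d' j) [0..<t]"
    let ?r = "sum_list (take i ?rg)"
    have md: "0 < m i * d i" using m_pos[OF i] d_pos[OF i] by simp
    have r: "?r < n"
      using block_index_less[of i ?rg 0] i md n_eq(1) by (simp add: sum_list_map_upt)
    have row: "\<Phi> z $$ (?r, y) = 0" if "y < n" for y
    proof -
      have "y < sum_list ?cg" using that n_eq(2) by (simp add: sum_list_map_upt)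
      then obtain j b where j: "j < length ?cg" "b < ?cg ! j" "y = sum_list (take j ?cg) + b"
        by (rule block_index_cases)
      then have "\<Phi> z $$ (?r, y) = group_block z i j $$ (0, b)"
        using md i by (simp add: group_block_def)
      then show ?thesis using zero[of j z] z j md by simp
    qed
    have "(\<Phi> z * \<Gamma> z) $$ (?r, ?r) = 0"
      using \<Phi>(1)[OF z] \<Gamma>[OF z] r row by (simp add: scalar_prod_def)
    then show False using \<Phi>\<Gamma>[OF z] r by simp
  qed
  have sizes: "copies t m d ! p = d (I ! p)" "copies t l d' ! q = d' (J ! q)" if "p < k" "q < k" for p q
    using that len by (simp_all add: rs_I cs_J flip: rs_def cs_def)
  have "block z p q = \<Theta> p q z" for z p q
    by (simp add: block_def \<Theta>_def rs_def cs_def)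
  then have "(\<forall>z\<in>\<Lambda>. invertible_mat (block z p q)) \<or>
      (\<forall>z\<in>\<Lambda>. block z p q = 0\<^sub>m (copies t m d ! p) (copies t l d' ! q))" if "p < k" "q < k" for p q
    using dichotomy[OF that] sizes[OF that] by auto
  then show ?thesis using zero_group nonzero_group by blast
qed

end
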